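(* Let $\Delta$ be a thick semi-regular right-angled building of irreducible type $(W,S)$, and let $U$ be its universal group with respect to transitive permutation groups $(G^s)_{s\in S}$. Let $s\in S$ and let $\mathcal T$ be an $s$-tree-wall of $\Delta$. Then any non-trivial normal subgroup $N$ of $U$ contains $\mathrm{Fix}_U(\mathcal T)$.
   Context: A Coxeter system $(W,S)$ is right-angled if for all distinct $s,t\in S$ the order of $st$ is $2$ or $\infty$; it is irreducible if its Coxeter diagram is connected. $\Delta$ is the unique building of type $(W,S)$ in which every $s$-panel has exactly $q_s$ chambers, for given cardinals $q_s$ $(s\in S)$; thick means all $q_s\ge3$. $\mathrm{Ch}(\Delta)$ is its set of chambers, $\delta$ its $W$-valued Weyl distance. Distinct chambers $c,d$ are $s$-adjacent if $\delta(c,d)=s$; $s$-panels are the classes of "equal or $s$-adjacent", and $\mathcal P_{s,c}$ is the $s$-panel containing $c$. A residue of type $J\subseteq S$ is a connected component of the graph on chambers keeping only edges with labels in $J$. $\mathrm{Aut}(\Delta)$ is the group of type-preserving automorphisms. An $s$-tree-wall is the set of all $s$-panels contained in a given residue of type $\{s\}\cup\{t\in S\setminus\{s\}:ts=st\}$ (equivalently, a class of parallel $s$-panels); its chambers are the chambers of that residue. $\mathrm{Fix}_U(\mathcal T)$ is the subgroup of elements of $U$ fixing every chamber of $\mathcal T$. Let $|Y_s|=q_s$. A legal $s$-coloring is a map $h_s\colon\mathrm{Ch}(\Delta)\to Y_s$ which is bijective on every $s$-panel and constant on every residue of type $S\setminus\{s\}$. Given legal $s$-colorings $h_s$ and transitive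 groups $G^s\le\mathrm{Sym}(Y_s)$ for all $s\in S$, the universal group is $$U=\{g\in\mathrm{Aut}(\Delta)\mid (h_s|_{\mathcal P_{s,gc}})\circ g\circ(h_s|_{\mathcal P_{s,c}})^{-1}\in G^s\text{ for all }s\in S,\ c\in\mathrm{Ch}(\Delta)\}.$$ *)

theory Defs
  imports "HOL-Algebra.Algebra" "HOL-Library.Equipollence"
begin

section \<open>Right-angled Coxeter systems\<close>

definition word_prod :: "('w, 'x) monoid_scheme \<Rightarrow> 'w list \<Rightarrow> 'w"
  where "word_prod W ws = foldr (\<otimes>\<^bsub>W\<^esub>) ws \<one>\<^bsub>W\<^esub>"

text \<open>One step of the presentation \<open>\<langle>S | (s t)\<^bsup>m(s,t)\<^esup> = 1\<rangle>\<close>: deletion of a relator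
  \<open>(s t)\<^bsup>m(s,t)\<^esup>\<close>, where \<open>m(s,t)\<close> is the order of \<open>s t\<close> in \<open>W\<close>. Since \<open>ord\<close> is \<open>0\<close> for elements
  of infinite order, \<open>m(s,t) = \<infinity>\<close> gives the empty relator, i.e. no relation. The case \<open>s = t\<close>
  gives the relators \<open>s s\<close>, so that no formal inverses of letters are needed.\<close>

inductive relator_step :: "('w, 'x) monoid_scheme \<Rightarrow> 'w set \<Rightarrow> 'w list \<Rightarrow> 'w list \<Rightarrow> bool"
  for W S where
  "\<lbrakk>u \<in> lists S; v \<in> lists S; s \<in> S; t \<in> S\<rbrakk> \<Longrightarrow>
    relator_step W S (u @ concat (replicate (group.ord W (s \<otimes>\<^bsub>W\<^esub> t)) [s, t]) @ v) (u @ v)"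

locale coxeter_system = group W for W (structure) +
  fixes S :: "'a set"
  assumes generators_closed: "S \<subseteq> carrier W"
    and generators_order: "s \<in> S \<Longrightarrow> ord s = 2"
    and generators_generate: "generate W S = carrier W"
    and presentation:
      "\<lbrakk>ws \<in> lists S; word_prod W ws = \<one>\<rbrakk> \<Longrightarrow> equivclp (relator_step W S) ws []"

definition right_angled :: "('w, 'x) monoid_scheme \<Rightarrow> 'w set \<Rightarrow> bool"
  where "right_angled W S \<longleftrightarrow>
    (\<forall>s\<in>S. \<forall>t\<in>S. s \<noteq> t \<longrightarrow> group.ord W (s \<otimes>\<^bsub>W\<^esub> t) = 2 \<or> group.ord W (s \<otimes>\<^bsub>W\<^esub> t) = 0)"

definition diagram_edges :: "('w, 'x) monoid_scheme \<Rightarrow> 'w set \<Rightarrow> ('w \<times> 'w) set"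
  where "diagram_edges W S =
    {(s, t). s \<in> S \<and> t \<in> S \<and> s \<noteq> t \<and> group.ord W (s \<otimes>\<^bsub>W\<^esub> t) \<noteq> 2}"

definition irreducible_type :: "('w, 'x) monoid_scheme \<Rightarrow> 'w set \<Rightarrow> bool"
  where "irreducible_type W S \<longleftrightarrow> (\<forall>s\<in>S. \<forall>t\<in>S. (s, t) \<in> (diagram_edges W S)\<^sup>*)"

definition word_length :: "('w, 'x) monoid_scheme \<Rightarrow> 'w set \<Rightarrow> 'w \<Rightarrow> nat"
  where "word_length W S w = (LEAST n. \<exists>ws\<in>lists S. length ws = n \<and> word_prod W ws = w)"


section \<open>Buildings\<close>

locale building = coxeter_system W S for W (structure) and S +
  fixes Ch :: "'c set" and \<delta> :: "'c \<Rightarrow> 'c \<Rightarrow> 'a"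
  assumes chambers_nonempty: "Ch \<noteq> {}"
    and \<delta>_closed: "\<lbrakk>c \<in> Ch; d \<in> Ch\<rbrakk> \<Longrightarrow> \<delta> c d \<in> carrier W"
    and \<delta>_eq_one_iff: "\<lbrakk>c \<in> Ch; d \<in> Ch\<rbrakk> \<Longrightarrow> \<delta> c d = \<one> \<longleftrightarrow> c = d"
    and \<delta>_step: "\<lbrakk>c \<in> Ch; d \<in> Ch; c' \<in> Ch; s \<in> S; \<delta> c' c = s\<rbrakk> \<Longrightarrow>
      \<delta> c' d = s \<otimes> \<delta> c d \<or> \<delta> c' d = \<delta> c d"
    and \<delta>_step_up: "\<lbrakk>c \<in> Ch; d \<in> Ch; c' \<in> Ch; s \<in> S; \<delta> c' c = s;
      word_length W S (s \<otimes> \<delta> c d) = word_length W S (\<delta> c d) + 1\<rbrakk> \<Longrightarrow> \<delta> c' d = s \<otimes> \<delta> c d"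
    and \<delta>_step_ex: "\<lbrakk>c \<in> Ch; d \<in> Ch; s \<in> S\<rbrakk> \<Longrightarrow>
      \<exists>c'\<in>Ch. \<delta> c' c = s \<and> \<delta> c' d = s \<otimes> \<delta> c d"

definition panel :: "'c set \<Rightarrow> ('c \<Rightarrow> 'c \<Rightarrow> 'w) \<Rightarrow> 'w \<Rightarrow> 'c \<Rightarrow> 'c set"
  where "panel Ch \<delta> s c = {d \<in> Ch. d = c \<or> \<delta> c d = s}"

definition residue :: "'c set \<Rightarrow> ('c \<Rightarrow> 'c \<Rightarrow> 'w) \<Rightarrow> 'w set \<Rightarrow> 'c \<Rightarrow> 'c set"
  where "residue Ch \<delta> J c = {d. (c, d) \<in> {(x, y). x \<in> Ch \<and> y \<in> Ch \<and> \<delta> x y \<in> J}\<^sup>*}"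

text \<open>The cardinals \<open>q\<^sub>s\<close> are given by sets \<open>Y s\<close> of that cardinality.\<close>

definition semi_regular :: "'w set \<Rightarrow> 'c set \<Rightarrow> ('c \<Rightarrow> 'c \<Rightarrow> 'w) \<Rightarrow> ('w \<Rightarrow> 'y set) \<Rightarrow> bool"
  where "semi_regular S Ch \<delta> Y \<longleftrightarrow> (\<forall>s\<in>S. \<forall>c\<in>Ch. panel Ch \<delta> s c \<approx> Y s)"

definition thick :: "'w set \<Rightarrow> ('w \<Rightarrow> 'y set) \<Rightarrow> bool"
  where "thick S Y \<longleftrightarrow> (\<forall>s\<in>S. {..<3::nat} \<lesssim> Y s)"

definition tree_wall ::
  "('w, 'x) monoid_scheme \<Rightarrow> 'w set \<Rightarrow> 'c set \<Rightarrow> ('c \<Rightarrow> 'c \<Rightarrow> 'w) \<Rightarrow> 'w \<Rightarrow> 'c set set \<Rightarrow> bool"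
  where "tree_wall W S Ch \<delta> s T \<longleftrightarrow>
    (\<exists>c\<in>Ch. T = {P \<in> panel Ch \<delta> s ` Ch.
      P \<subseteq> residue Ch \<delta> ({s} \<union> {t \<in> S - {s}. t \<otimes>\<^bsub>W\<^esub> s = s \<otimes>\<^bsub>W\<^esub> t}) c})"

text \<open>Carrier of a subgroup of \<^term>\<open>BijGroup Ch\<close>; automorphisms are therefore extensional
  functions on \<open>Ch\<close>.\<close>

definition Aut :: "'c set \<Rightarrow> ('c \<Rightarrow> 'c \<Rightarrow> 'w) \<Rightarrow> ('c \<Rightarrow> 'c) set"
  where "Aut Ch \<delta> = {g \<in> Bij Ch. \<forall>c\<in>Ch. \<forall>d\<in>Ch. \<delta> (g c) (g d) = \<delta> c d}"


section \<open>Universal groups\<close>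

definition legal_coloring ::
  "'w set \<Rightarrow> 'c set \<Rightarrow> ('c \<Rightarrow> 'c \<Rightarrow> 'w) \<Rightarrow> 'w \<Rightarrow> 'y set \<Rightarrow> ('c \<Rightarrow> 'y) \<Rightarrow> bool"
  where "legal_coloring S Ch \<delta> s Ys hs \<longleftrightarrow>
    hs \<in> Ch \<rightarrow> Ys \<and>
    (\<forall>c\<in>Ch. bij_betw hs (panel Ch \<delta> s c) Ys) \<and>
    (\<forall>c\<in>Ch. \<forall>d\<in>residue Ch \<delta> (S - {s}) c. hs d = hs c)"

text \<open>The map \<open>(h\<^sub>s|\<^bsub>P(s,gc)\<^esub>) \<circ> g \<circ> (h\<^sub>s|\<^bsub>P(s,c)\<^esub>)\<^sup>-\<^sup>1\<close>, as an extensional function on \<open>Y\<^sub>s\<close>.\<close>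

definition local_action ::
  "'c set \<Rightarrow> ('c \<Rightarrow> 'c \<Rightarrow> 'w) \<Rightarrow> 'w \<Rightarrow> 'y set \<Rightarrow> ('c \<Rightarrow> 'y) \<Rightarrow> ('c \<Rightarrow> 'c) \<Rightarrow> 'c \<Rightarrow> 'y \<Rightarrow> 'y"
  where "local_action Ch \<delta> s Ys hs g c =
    (\<lambda>y\<in>Ys. hs (g (inv_into (panel Ch \<delta> s c) hs y)))"

definition universal_group ::
  "'w set \<Rightarrow> 'c set \<Rightarrow> ('c \<Rightarrow> 'c \<Rightarrow> 'w) \<Rightarrow> ('w \<Rightarrow> 'y set) \<Rightarrow> ('w \<Rightarrow> 'c \<Rightarrow> 'y) \<Rightarrow>
    ('w \<Rightarrow> ('y \<Rightarrow> 'y) set) \<Rightarrow> ('c \<Rightarrow> 'c) set"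
  where "universal_group S Ch \<delta> Y h G =
    {g \<in> Aut Ch \<delta>. \<forall>s\<in>S. \<forall>c\<in>Ch. local_action Ch \<delta> s (Y s) (h s) g c \<in> G s}"

definition transitive_perm_group :: "'y set \<Rightarrow> ('y \<Rightarrow> 'y) set \<Rightarrow> bool"
  where "transitive_perm_group Ys H \<longleftrightarrow>
    subgroup H (BijGroup Ys) \<and> transitive_action (BijGroup Ys\<lparr>carrier := H\<rparr>) Ys (\<lambda>g. g)"

definition fixator :: "('c \<Rightarrow> 'c) set \<Rightarrow> 'c set set \<Rightarrow> ('c \<Rightarrow> 'c) set"
  where "fixator U T = {g \<in> U. \<forall>c\<in>\<Union>T. g c = c}"

end

theory Submission
  imports Defs
begin

text \<open>The proof carries Tits' argument for groups acting on trees over to right-angled buildings. Half-trees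
  become \<^emph>\<open>wings\<close>: \<open>wing s c\<close> consists of the chambers whose projection to the \<open>s\<close>-panel of \<open>c\<close>
  is \<open>c\<close>. The wings of the chambers of one \<open>s\<close>-panel \<open>P\<close> partition the building, and a panel that
  meets two of these wings belongs to the \<open>s\<close>-tree-wall of \<open>P\<close> (\<open>wing_boundary\<close>). Hence an
  element \<open>g\<close> of \<open>U\<close> that fixes the tree-wall can be restricted to the union of any set of these wings
  and continued by the identity, because membership in \<open>U\<close> is decided panel by panel
  (\<open>panelwise_in_U\<close>).

  Suppose that \<open>g\<close> is supported on such a union \<open>A\<close>, that \<open>n \<in> N\<close> maps some \<open>H \<supseteq> A\<close> into itself,
  and that \<open>n H\<close> is disjoint from \<open>A\<close>. Then the sets \<open>n\<^sup>k A\<close> are pairwise disjoint, so the infinite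
  product \<open>u\<close> of all \<open>n\<^sup>k g n\<^sup>-\<^sup>k\<close> is defined and lies in \<open>U\<close>, and \<open>g = u n u\<^sup>-\<^sup>1 n\<^sup>-\<^sup>1\<close> lies in \<open>N\<close>
  (\<open>contraction\<close>). If \<open>A\<close> misses the wings of two chambers \<open>p\<close> and \<open>q\<close> of \<open>P\<close>, it is enough that
  \<open>n\<close> maps the complement of the wing of \<open>p\<close> into the wing of \<open>q\<close>. An arbitrary \<open>g\<close> fixing the
  tree-wall is a product of three such elements: by thickness \<open>P\<close> has three chambers \<open>p\<close>, \<open>q\<close> and
  \<open>q'\<close>, and each of \<open>{p}\<close>, \<open>{q}\<close> and \<open>P - {p, q}\<close> misses two of them.

  To find \<open>n\<close>, start from a non-trivial \<open>m \<in> N\<close>. It maps some wing to a set disjoint from it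
  (\<open>moved_wing_exists\<close>). By irreducibility that wing contains the complement of some \<open>s\<close>-wing
  (\<open>wing_contains_wing_complement\<close>). As \<open>U\<close> is transitive on chambers, a conjugate of \<open>m\<close> maps the
  complement of any given \<open>s\<close>-wing into that wing, and the product of two such elements, one for \<open>p\<close>
  and one for \<open>q\<close>, is the desired \<open>n\<close> (\<open>wing_complement_into_wing\<close>).

  Chamber transitivity of \<open>U\<close> amounts to the homogeneity of the building: an automorphism that permutes the
  colors in a prescribed way is built along galleries running away from a base chamber. The construction is
  consistent because two left descents of an element of a right-angled Coxeter group commute. This
  fact, and the folding property behind \<open>wing_boundary\<close>, come from the deletion condition, which is
  derived from the presentation by counting reflections modulo 2.

  If \<open>S = {s}\<close>, the tree-wall contains all chambers and its fixator is trivial.\<close>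

section \<open>Words in a Coxeter group\<close>

context coxeter_system
begin

lemma in_lists_iff_subset [simp]: "ws \<in> lists A \<longleftrightarrow> set ws \<subseteq> A"
  by (auto simp: in_lists_conv_set)

lemma S_closed [simp]: "s \<in> S \<Longrightarrow> s \<in> carrier W"
  using generators_closed by blast

lemma S_square [simp]: "s \<in> S \<Longrightarrow> s \<otimes> s = \<one>"
  using pow_ord_eq_1[of s] generators_order[of s] by (simp add: numeral_2_eq_2)

lemma S_cancel [simp]: "s \<in> S \<Longrightarrow> x \<in> carrier W \<Longrightarrow> s \<otimes> (s \<otimes> x) = x"
  by (simp flip: m_assoc)

lemma S_cancel_right [simp]: "s \<in> S \<Longrightarrow> x \<in> carrier W \<Longrightarrow> x \<otimes> s \<otimes> s = x"
  by (simp add: m_assoc)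

lemma S_inv [simp]: "s \<in> S \<Longrightarrow> inv s = s"
  by (simp add: inv_equality)

lemma S_neq_one [simp]: "s \<in> S \<Longrightarrow> s \<noteq> \<one>"
  using generators_order[of s] ord_id by force

lemma word_prod_Nil [simp]: "word_prod W [] = \<one>"
  by (simp add: word_prod_def)

lemma word_prod_Cons [simp]: "word_prod W (s # ws) = s \<otimes> word_prod W ws"
  by (simp add: word_prod_def)

lemma word_prod_closed [simp]: "ws \<in> lists S \<Longrightarrow> word_prod W ws \<in> carrier W"
  by (induction ws) auto

lemma word_prod_append [simp]:
  "us \<in> lists S \<Longrightarrow> vs \<in> lists S \<Longrightarrow> word_prod W (us @ vs) = word_prod W us \<otimes> word_prod W vs"
  by (induction us) (auto simp: m_assoc)

lemma word_prod_rev: "ws \<in> lists S \<Longrightarrow> word_prod W (rev ws) = inv (word_prod W ws)"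
  by (induction ws) (auto simp: inv_mult_group)

lemma word_exists:
  assumes "w \<in> carrier W" shows "\<exists>ws\<in>lists S. word_prod W ws = w"
proof -
  have "w \<in> generate W S" using assms generators_generate by simp
  then show ?thesis
  proof induction
    case one
    have "word_prod W [] = \<one>" "[] \<in> lists S" by auto
    then show ?case by blast
  next
    case (incl s)
    then have "word_prod W [s] = s" "[s] \<in> lists S" by auto
    then show ?case by blast
  next
    case (inv s)
    then have "word_prod W [s] = inv s" "[s] \<in> lists S" by auto
    then show ?case by blast
  next
    case (eng u v)
    then obtain us vs where "us \<in> lists S" "word_prod W us = u" "vs \<in> lists S" "word_prod W vs = v"
      by blast
    then have "us @ vs \<in> lists S" "word_prod W (us @ vs) = u \<otimes> v" by auto
    then show ?case by blast
  qed
qed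

abbreviation len :: "'a \<Rightarrow> nat" where "len \<equiv> word_length W S"

lemma len_le: "ws \<in> lists S \<Longrightarrow> len (word_prod W ws) \<le> length ws"
  unfolding word_length_def by (rule Least_le) blast

lemma reduced_word_exists:
  assumes "w \<in> carrier W" obtains ws where "ws \<in> lists S" "word_prod W ws = w" "length ws = len w"
proof -
  obtain ws where "ws \<in> lists S" "word_prod W ws = w" using word_exists assms by blast
  then have "\<exists>n. \<exists>ws\<in>lists S. length ws = n \<and> word_prod W ws = w" by blast
  from LeastI_ex[OF this] obtain vs where "vs \<in> lists S" "length vs = len w" "word_prod W vs = w"
    unfolding word_length_def by (elim bexE conjE)
  then show ?thesis by (intro that)
qed

lemma len_one [simp]: "len \<one> = 0"
  using len_le[of "[]"] by simp

lemma len_eq_0: "w \<in> carrier W \<Longrightarrow> len w = 0 \<Longrightarrow> w = \<one>"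
  by (erule reduced_word_exists) auto

lemma len_inv_le:
  assumes "w \<in> carrier W" shows "len (inv w) \<le> len w"
proof -
  obtain ws where "ws \<in> lists S" "word_prod W ws = w" "length ws = len w"
    using reduced_word_exists[OF assms] .
  then show ?thesis using len_le[of "rev ws"] by (simp add: word_prod_rev)
qed

lemma len_inv [simp]: "w \<in> carrier W \<Longrightarrow> len (inv w) = len w"
  using len_inv_le[of w] len_inv_le[of "inv w"] by simp

section \<open>Reflections and the deletion condition\<close>

text \<open>For a word \<open>s\<^sub>1 \<dots> s\<^sub>n\<close> these are the reflections \<open>s\<^sub>1 \<dots> s\<^sub>i \<dots> s\<^sub>1\<close>, that is, the walls crossed by the
  gallery that the word describes in the Coxeter complex.\<close>

fun reflections :: "'a list \<Rightarrow> 'a list" where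
  "reflections [] = []"
| "reflections (s # ws) = s # map (\<lambda>t. s \<otimes> t \<otimes> s) (reflections ws)"

lemma reflections_closed: "ws \<in> lists S \<Longrightarrow> set (reflections ws) \<subseteq> carrier W"
  by (induction ws) auto

lemma length_reflections [simp]: "length (reflections ws) = length ws"
  by (induction ws) auto

text \<open>Deleting a relator changes the number of times a wall is crossed, but not its parity.\<close>

definition odd_reflection :: "'a list \<Rightarrow> 'a \<Rightarrow> bool" where
  "odd_reflection ws t \<longleftrightarrow> odd (count_list (reflections ws) t)"

lemma count_list_conj:
  assumes "p \<in> carrier W" "t \<in> carrier W" "set xs \<subseteq> carrier W"
  shows "count_list (map (\<lambda>x. p \<otimes> x \<otimes> inv p) xs) t = count_list xs (inv p \<otimes> t \<otimes> p)"
  using assms(3)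
proof (induction xs)
  case (Cons x xs)
  then have x: "x \<in> carrier W" by simp
  have "p \<otimes> x \<otimes> inv p = t \<longleftrightarrow> x = inv p \<otimes> t \<otimes> p"
    using assms(1,2) x by (metis inv_closed inv_solve_left' inv_solve_right m_assoc m_closed)
  with Cons show ?case by auto
qed simp

lemma reflections_append:
  assumes "us \<in> lists S" "vs \<in> lists S"
  shows "reflections (us @ vs) =
    reflections us @ map (\<lambda>t. word_prod W us \<otimes> t \<otimes> inv (word_prod W us)) (reflections vs)"
  using assms(1)
proof (induction us)
  case Nil
  have "map (\<lambda>t. \<one> \<otimes> t \<otimes> inv \<one>) (reflections vs) = map (\<lambda>t. t) (reflections vs)"
    using reflections_closed[OF assms(2)] by (intro map_cong) auto
  then show ?case by simp
next
  case (Cons s us)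
  then have s: "s \<in> S" and us: "us \<in> lists S" by auto
  have "s \<otimes> (word_prod W us \<otimes> t \<otimes> inv (word_prod W us)) \<otimes> s =
        s \<otimes> word_prod W us \<otimes> t \<otimes> inv (s \<otimes> word_prod W us)" if "t \<in> carrier W" for t
    using that s us by (simp add: inv_mult_group m_assoc)
  then show ?case using Cons reflections_closed[OF assms(2)] by (auto simp: us)
qed

lemma odd_reflection_append:
  assumes "us \<in> lists S" "vs \<in> lists S" "t \<in> carrier W"
  shows "odd_reflection (us @ vs) t \<longleftrightarrow>
    (odd_reflection us t \<noteq> odd_reflection vs (inv (word_prod W us) \<otimes> t \<otimes> word_prod W us))"
  using assms count_list_conj[of "word_prod W us" t "reflections vs"] reflections_closed[of vs]
  by (simp add: odd_reflection_def reflections_append)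

lemma reflections_relator:
  assumes "s \<in> S" "t \<in> S"
  shows "reflections (concat (replicate m [s, t])) = map (\<lambda>i. (s \<otimes> t) [^] i \<otimes> s) [0..<2*m]"
proof (induction m)
  case (Suc m)
  have *: "[0..<2 * Suc m] = 0 # 1 # map (\<lambda>i. i + 2) [0..<2*m]"
  proof -
    have "map (\<lambda>i. i + 2) [0..<2*m] = [2..<2*m+2]" using map_add_upt[of 2 "2*m"] by simp
    then show ?thesis by (simp add: upt_rec numeral_2_eq_2)
  qed
  have "s \<otimes> (t \<otimes> ((s \<otimes> t) [^] i \<otimes> s) \<otimes> t) \<otimes> s = (s \<otimes> t) [^] (i + 2) \<otimes> s" for i :: nat
  proof -
    have "(s \<otimes> t) [^] (i + 2) = (s \<otimes> t) \<otimes> (s \<otimes> t) [^] i \<otimes> (s \<otimes> t)"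
      using assms by (simp add: numeral_2_eq_2 flip: nat_pow_mult nat_pow_Suc2)
    then show ?thesis using assms by (simp add: m_assoc)
  qed
  with Suc assms show ?case unfolding * by (simp add: m_assoc del: upt_Suc)
qed simp

lemma word_prod_relator:
  assumes "s \<in> S" "t \<in> S"
  shows "word_prod W (concat (replicate m [s, t])) = (s \<otimes> t) [^] m"
proof (induction m)
  case (Suc m)
  then have "word_prod W (concat (replicate (Suc m) [s, t])) = s \<otimes> t \<otimes> (s \<otimes> t) [^] m"
    using assms by (simp add: m_assoc)
  also have "\<dots> = (s \<otimes> t) [^] Suc m" using assms by (intro nat_pow_Suc2[symmetric]) simp
  finally show ?case .
qed simp

lemma relator_in_lists: "s \<in> S \<Longrightarrow> t \<in> S \<Longrightarrow> concat (replicate m [s, t]) \<in> lists S"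
  by (induction m) auto

text \<open>A relator \<open>(s t)\<^sup>m\<close> lists the reflections \<open>(s t)\<^sup>i s\<close> for \<open>i < 2 m\<close>. This list runs twice through the
  same \<open>m\<close> elements, and since the relator has product \<open>\<one>\<close> the letters after it contribute the same
  reflections with and without it.\<close>

lemma relator_step_invariant:
  assumes "relator_step W S ws ws'"
  shows "(t \<in> carrier W \<longrightarrow> odd_reflection ws t = odd_reflection ws' t) \<and> even (length ws) = even (length ws')"
  using assms
proof cases
  case (1 u v a b)
  define m where "m = ord (a \<otimes> b)"
  define r where "r = concat (replicate m [a, b])"
  define f where "f = (\<lambda>i::nat. (a \<otimes> b) [^] i \<otimes> a)"
  have ab: "a \<in> S" "b \<in> S" and uv: "u \<in> lists S" "v \<in> lists S" by fact+
  have ws: "ws = u @ r @ v" "ws' = u @ v" using 1(1,2) by (simp_all add: r_def m_def)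
  have pow_m: "(a \<otimes> b) [^] m = \<one>" using ab by (simp add: m_def)
  have r: "r \<in> lists S" unfolding r_def using ab by (rule relator_in_lists)
  have r1: "word_prod W r = \<one>" unfolding r_def using ab pow_m by (simp add: word_prod_relator)
  have "f (i + m) = f i" for i
    unfolding f_def using ab nat_pow_mult[of "a \<otimes> b" i m, symmetric] pow_m by simp
  then have "map f (map (\<lambda>i. i + m) [0..<m]) = map f [0..<m]" by simp
  moreover have "[0..<2 * m] = [0..<m] @ map (\<lambda>i. i + m) [0..<m]"
    unfolding map_add_upt mult_2 by (rule upt_add_eq_append) simp
  ultimately have "map f [0..<2 * m] = map f [0..<m] @ map f [0..<m]" by (simp only: map_append)
  then have no: "\<not> odd_reflection r x" for x
    unfolding r_def odd_reflection_def reflections_relator[OF ab] f_def[symmetric] by simp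
  have "odd_reflection (u @ r @ v) t = odd_reflection (u @ v) t" if t: "t \<in> carrier W"
  proof -
    have "r @ v \<in> lists S" using r uv by simp
    moreover have "inv word_prod W u \<otimes> t \<otimes> word_prod W u \<in> carrier W" using uv t by simp
    ultimately show ?thesis
      using odd_reflection_append[OF uv(1) _ t] odd_reflection_append[OF r uv(2)] uv no r1 by simp
  qed
  moreover have "length r = 2 * m" unfolding r_def by (induction m) auto
  ultimately show ?thesis using ws by simp
qed

lemma trivial_word_invariant:
  assumes "ws \<in> lists S" "word_prod W ws = \<one>"
  shows "t \<in> carrier W \<Longrightarrow> \<not> odd_reflection ws t" "even (length ws)"
proof -
  have "equivclp (relator_step W S) ws []" using presentation assms by blast
  then have *: "(t \<in> carrier W \<longrightarrow> odd_reflection ws t = odd_reflection [] t) \<and> even (length ws) = even (length ([]::'a list))"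
    for t
  proof (induction rule: equivclp_induct)
    case (step y z)
    then show ?case using relator_step_invariant[of y z t] relator_step_invariant[of z y t] by argo
  qed simp
  show "t \<in> carrier W \<Longrightarrow> \<not> odd_reflection ws t" using *[of t] by (simp add: odd_reflection_def)
  show "even (length ws)" using *[of \<one>] by simp
qed

text \<open>The presentation speaks about words with trivial product, so each of the two words is followed by the
  reverse of the second one.\<close>

lemma equal_words_invariant:
  assumes "us \<in> lists S" "vs \<in> lists S" "word_prod W us = word_prod W vs"
  shows "t \<in> carrier W \<Longrightarrow> odd_reflection us t = odd_reflection vs t" "even (length us) = even (length vs)"
proof -
  have rv: "rev vs \<in> lists S" using assms by auto
  have one: "word_prod W (us @ rev vs) = \<one>" "word_prod W (vs @ rev vs) = \<one>"
    using assms rv by (simp_all add: word_prod_rev)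
  have in_lists: "us @ rev vs \<in> lists S" "vs @ rev vs \<in> lists S" using assms by auto
  show "even (length us) = even (length vs)"
    using trivial_word_invariant(2)[OF in_lists(1) one(1)] by simp
  show "odd_reflection us t = odd_reflection vs t" if "t \<in> carrier W"
    using trivial_word_invariant(1)[OF in_lists(1) one(1) that]
      trivial_word_invariant(1)[OF in_lists(2) one(2) that] assms rv that
    by (simp add: odd_reflection_append)
qed

text \<open>A reflection that occurs exactly once has odd multiplicity in every word with the same product, so such a
  word has at least as many letters.\<close>

lemma distinct_reflections_reduced:
  assumes "ws \<in> lists S" "distinct (reflections ws)"
  shows "len (word_prod W ws) = length ws"
proof -
  obtain vs where vs: "vs \<in> lists S" "word_prod W vs = word_prod W ws" "length vs = len (word_prod W ws)"
    using reduced_word_exists[OF word_prod_closed[OF assms(1)]] .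
  have "set (reflections ws) \<subseteq> set (reflections vs)"
  proof
    fix t assume t: "t \<in> set (reflections ws)"
    then have tc: "t \<in> carrier W" using reflections_closed assms(1) by blast
    have "count_list xs t = 1" if "distinct xs" "t \<in> set xs" for xs :: "'a list"
      using that by (induction xs) auto
    then have "odd_reflection ws t" using t assms(2) by (simp add: odd_reflection_def)
    then have "odd_reflection vs t" using equal_words_invariant(1)[OF vs(1) assms(1) vs(2) tc] by simp
    then show "t \<in> set (reflections vs)" unfolding odd_reflection_def by (metis count_notin even_zero)
  qed
  then have "length ws \<le> length vs"
    by (metis assms(2) card_length card_mono distinct_card finite_set length_reflections order_trans)
  then show ?thesis using vs(3) len_le[OF assms(1)] by simp
qed

lemma in_set_reflections:
  assumes "ws \<in> lists S" "t \<in> set (reflections ws)"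
  shows "\<exists>v b x. ws = v @ b # x \<and> t = word_prod W v \<otimes> b \<otimes> inv (word_prod W v)"
  using assms
proof (induction ws arbitrary: t)
  case (Cons s ws)
  show ?case
  proof (cases "t = s")
    case True
    then have "s # ws = [] @ s # ws \<and> t = word_prod W [] \<otimes> s \<otimes> inv (word_prod W [])"
      using Cons by simp
    then show ?thesis by blast
  next
    case False
    then obtain u where u: "u \<in> set (reflections ws)" "t = s \<otimes> u \<otimes> s" using Cons.prems by auto
    then obtain v b x where v: "ws = v @ b # x" "u = word_prod W v \<otimes> b \<otimes> inv (word_prod W v)"
      using Cons.IH[OF u(1)] by auto
    have "s \<in> S" "b \<in> S" "v \<in> lists S" using Cons.hyps v(1) by auto
    then have "t = word_prod W (s # v) \<otimes> b \<otimes> inv (word_prod W (s # v))"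
      unfolding u(2) v(2) by (simp add: inv_mult_group m_assoc)
    with v(1) show ?thesis by (metis append_Cons)
  qed
qed simp

text \<open>If the reflections at two positions coincide, cancelling the common prefix gives the displayed relation
  between the two letters; it allows both of them to be deleted.\<close>

lemma deletion:
  assumes "ws \<in> lists S" "len (word_prod W ws) < length ws"
  shows "\<exists>u a v b x. ws = u @ a # v @ b # x \<and> a \<otimes> word_prod W v = word_prod W v \<otimes> b"
proof -
  have "\<not> distinct (reflections ws)" using assms distinct_reflections_reduced by force
  then show ?thesis using assms(1)
  proof (induction ws)
    case (Cons s ws)
    then have s: "s \<in> S" and ws: "ws \<in> lists S" by auto
    show ?case
    proof (cases "distinct (reflections ws)")
      case True
      have inj: "inj_on (\<lambda>t. s \<otimes> t \<otimes> s) (carrier W)"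
        using s by (intro inj_onI) (metis S_closed m_closed r_cancel l_cancel)
      then have "distinct (map (\<lambda>t. s \<otimes> t \<otimes> s) (reflections ws))"
        using True ws by (simp add: distinct_map inj_on_subset[OF _ reflections_closed])
      then have "s \<in> (\<lambda>t. s \<otimes> t \<otimes> s) ` set (reflections ws)" using Cons.prems by auto
      then obtain t where t: "t \<in> set (reflections ws)" "s = s \<otimes> t \<otimes> s" by auto
      have tc: "t \<in> carrier W" using t reflections_closed ws by blast
      then have "t = s" using t(2) s by (metis S_cancel S_closed S_square m_assoc m_closed r_one)
      then obtain v b x where v: "ws = v @ b # x" "s = word_prod W v \<otimes> b \<otimes> inv (word_prod W v)"
        using in_set_reflections[OF ws] t by blast
      then have vb: "word_prod W v \<in> carrier W" "b \<in> carrier W" using ws by auto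
      then have "s \<otimes> word_prod W v = word_prod W v \<otimes> b"
        by (subst v(2)) (simp add: m_assoc)
      then have "s # ws = [] @ s # v @ b # x \<and> s \<otimes> word_prod W v = word_prod W v \<otimes> b"
        using v by simp
      then show ?thesis by blast
    next
      case False
      then obtain u a v b x where "ws = u @ a # v @ b # x" "a \<otimes> word_prod W v = word_prod W v \<otimes> b"
        using Cons.IH ws by blast
      then have "s # ws = (s # u) @ a # v @ b # x \<and> a \<otimes> word_prod W v = word_prod W v \<otimes> b" by simp
      then show ?thesis by blast
    qed
  qed simp
qed

lemma len_mult_left:
  assumes "s \<in> S" "w \<in> carrier W"
  shows "len (s \<otimes> w) = len w + 1 \<or> len w = len (s \<otimes> w) + 1"
proof -
  obtain ws where ws: "ws \<in> lists S" "word_prod W ws = w" "length ws = len w"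
    using reduced_word_exists[OF assms(2)] .
  obtain vs where vs: "vs \<in> lists S" "word_prod W vs = s \<otimes> w" "length vs = len (s \<otimes> w)"
    using reduced_word_exists[of "s \<otimes> w"] assms by auto
  have "len (s \<otimes> w) \<le> Suc (len w)"
    using len_le[of "s # ws"] ws assms by simp
  moreover have "len w \<le> Suc (len (s \<otimes> w))"
    using len_le[of "s # vs"] vs assms by simp
  moreover have "even (length (s # ws)) = even (length vs)"
    by (rule equal_words_invariant(2)) (use ws vs assms in auto)
  then have "even (len w) \<noteq> even (len (s \<otimes> w))" using ws vs by auto
  ultimately show ?thesis by (metis Suc_eq_plus1 le_Suc_eq le_antisym not_less_eq_eq)
qed

lemma len_mult_right:
  assumes "s \<in> S" "w \<in> carrier W"
  shows "len (w \<otimes> s) = len w + 1 \<or> len w = len (w \<otimes> s) + 1"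
proof -
  have "len (w \<otimes> s) = len (s \<otimes> inv w)"
    using assms len_inv[of "w \<otimes> s"] by (simp add: inv_mult_group)
  then show ?thesis using len_mult_left[of s "inv w"] assms by simp
qed

lemma len_generator [simp]: "s \<in> S \<Longrightarrow> len s = 1"
  using len_mult_left[of s \<one>] by simp

lemma deletion_word_prod:
  assumes "u @ a # v @ b # x \<in> lists S" "a \<otimes> word_prod W v = word_prod W v \<otimes> b"
  shows "word_prod W (u @ a # v @ b # x) = word_prod W (u @ v @ x)"
proof -
  have c: "a \<in> S" "b \<in> S" "u \<in> lists S" "v \<in> lists S" "x \<in> lists S" using assms(1) by auto
  have "a \<otimes> (word_prod W v \<otimes> (b \<otimes> word_prod W x)) = a \<otimes> word_prod W v \<otimes> (b \<otimes> word_prod W x)"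
    using c by (simp add: m_assoc)
  also have "\<dots> = word_prod W v \<otimes> word_prod W x" using c assms(2) by (simp add: m_assoc)
  finally show ?thesis using c by simp
qed

text \<open>Deletion applied to \<open>ws @ [a]\<close> removes two letters. One of them is the final \<open>a\<close>, as \<open>ws\<close> is
  reduced.\<close>

lemma exchange:
  assumes ws: "ws \<in> lists S" "word_prod W ws = w" "length ws = len w" and a: "a \<in> S"
    and less: "len (w \<otimes> a) < len w"
  shows "\<exists>u b v. ws = u @ b # v \<and> word_prod W (u @ v) = w \<otimes> a"
proof -
  note ws(2)[symmetric, simp]
  have "len (word_prod W (ws @ [a])) < length (ws @ [a])" using ws less a by simp
  then obtain u b v d x where eq: "ws @ [a] = u @ b # v @ d # x"
    and bd: "b \<otimes> word_prod W v = word_prod W v \<otimes> d"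
    using deletion[of "ws @ [a]"] ws(1) a by auto
  show ?thesis
  proof (cases x rule: rev_cases)
    case Nil
    then have ws_eq: "ws = u @ b # v" "a = d" using eq by auto
    have "word_prod W (u @ v) = word_prod W (u @ b # v @ d # [])"
      using deletion_word_prod[of u b v d "[]"] bd ws a unfolding ws_eq by simp
    then have "ws = u @ b # v \<and> word_prod W (u @ v) = w \<otimes> a" using ws_eq ws a by (simp add: m_assoc)
    then show ?thesis by blast
  next
    case (snoc y c)
    then have ws_eq: "ws = u @ b # v @ d # y" using eq by auto
    have "word_prod W ws = word_prod W (u @ v @ y)"
      unfolding ws_eq by (rule deletion_word_prod) (use ws(1) ws_eq bd in auto)
    moreover have "len (word_prod W (u @ v @ y)) \<le> length (u @ v @ y)"
      by (rule len_le) (use ws(1) ws_eq in auto)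
    ultimately have False using ws(3) ws_eq by simp
    then show ?thesis ..
  qed
qed

text \<open>Exchange applied to \<open>s # ws\<close> and \<open>r\<close>, with \<open>ws\<close> a reduced word for \<open>w\<close>, removes a letter. If this
  were not the initial \<open>s\<close>, then \<open>w \<otimes> r\<close> would be shorter than \<open>w\<close>.\<close>

lemma folding:
  assumes s: "s \<in> S" and r: "r \<in> S" and w: "w \<in> carrier W"
    and up: "len (s \<otimes> w) = len w + 1" "len (w \<otimes> r) = len w + 1"
    and less: "len (s \<otimes> w \<otimes> r) < len w + 2"
  shows "s \<otimes> w = w \<otimes> r"
proof -
  obtain ws where ws: "ws \<in> lists S" "word_prod W ws = w" "length ws = len w"
    using reduced_word_exists[OF w] .
  have "len (s \<otimes> w \<otimes> r) < len (s \<otimes> w)"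
    using len_mult_right[of r "s \<otimes> w"] s r w up less by auto
  then obtain u b v where split: "s # ws = u @ b # v" "word_prod W (u @ v) = s \<otimes> w \<otimes> r"
    using exchange[of "s # ws" "s \<otimes> w" r] s r ws up(1) by auto
  have "w = s \<otimes> w \<otimes> r"
  proof (cases u)
    case Nil
    then show ?thesis using split ws by simp
  next
    case (Cons c u')
    then have ws_eq: "ws = u' @ b # v" "c = s" using split by auto
    have u'v: "u' @ v \<in> lists S" using ws ws_eq by auto
    have "s \<otimes> word_prod W (u' @ v) = s \<otimes> (w \<otimes> r)" using split Cons ws_eq s r w by (simp add: m_assoc)
    then have "word_prod W (u' @ v) = w \<otimes> r"
      using u'v s r w l_cancel[of s] by (metis S_closed m_closed word_prod_closed)
    then have "len (w \<otimes> r) \<le> length (u' @ v)" using len_le[OF u'v] by simp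
    then show ?thesis using up(2) ws ws_eq by simp
  qed
  then have "w \<otimes> r = s \<otimes> w \<otimes> r \<otimes> r" by simp
  then show ?thesis using s r w by simp
qed

text \<open>The recursion runs from the right, so that \<open>f\<close> is always the last letter and every suffix is an alternating
  word with the same two parameters.\<close>

fun alternating :: "nat \<Rightarrow> 'a \<Rightarrow> 'a \<Rightarrow> 'a list" where
  "alternating 0 e f = []"
| "alternating (Suc n) e f = alternating n f e @ [f]"

lemma set_alternating: "set (alternating n e f) \<subseteq> {e, f}"
proof (induction n arbitrary: e f)
  case (Suc n)
  from Suc[of f e] show ?case by auto
qed simp

lemma alternating_closed [simp]: "e \<in> S \<Longrightarrow> f \<in> S \<Longrightarrow> set (alternating n e f) \<subseteq> S"
  using set_alternating[of n e f] by auto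

lemma length_alternating [simp]: "length (alternating n e f) = n"
  by (induction n arbitrary: e f) auto

lemma alternating_suffix: "alternating n e f = u @ v \<Longrightarrow> v = alternating (length v) e f"
proof (induction n arbitrary: e f v)
  case (Suc n)
  show ?case
  proof (cases v rule: rev_cases)
    case (snoc v' x)
    then have "x = f" "alternating n f e = u @ v'" using Suc.prems by auto
    then show ?thesis using Suc.IH[of f e v'] snoc by simp
  qed simp
qed simp

text \<open>In a dihedral group the two alternating words of length \<open>n\<close> agree only if \<open>(e f)\<^sup>n\<close> is trivial.\<close>

lemma word_prod_alternating:
  assumes "e \<in> S" "f \<in> S"
  shows "word_prod W (alternating n e f) = word_prod W (alternating n f e) \<otimes> (e \<otimes> f) [^] n"
  using assms
proof (induction n arbitrary: e f)
  case (Suc n)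
  have closed: "word_prod W (alternating n e f) \<in> carrier W" "word_prod W (alternating n f e) \<in> carrier W"
    using Suc.prems by auto
  have comm: "e \<otimes> (e \<otimes> f) [^] Suc n = (f \<otimes> e) [^] n \<otimes> f"
  proof -
    have "f \<otimes> (e \<otimes> f) [^] k = (f \<otimes> e) [^] k \<otimes> f" for k :: nat
    proof (induction k)
      case (Suc k)
      have "f \<otimes> (e \<otimes> f) [^] Suc k = f \<otimes> (e \<otimes> f) [^] k \<otimes> e \<otimes> f"
        using \<open>e \<in> S\<close> \<open>f \<in> S\<close> by (simp add: m_assoc)
      also have "\<dots> = (f \<otimes> e) [^] Suc k \<otimes> f"
        using \<open>e \<in> S\<close> \<open>f \<in> S\<close> Suc by (simp add: m_assoc)
      finally show ?case .
    qed (use Suc.prems in simp)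
    moreover have "e \<otimes> (e \<otimes> f) [^] Suc n = e \<otimes> (e \<otimes> f \<otimes> (e \<otimes> f) [^] n)"
      using Suc.prems nat_pow_Suc2[of "e \<otimes> f" n] by simp
    ultimately show ?thesis using Suc.prems by (simp add: m_assoc del: nat_pow_Suc)
  qed
  have "word_prod W (alternating (Suc n) e f) = word_prod W (alternating n f e) \<otimes> f"
    using Suc.prems by simp
  also have "\<dots> = word_prod W (alternating n e f) \<otimes> ((f \<otimes> e) [^] n \<otimes> f)"
    using Suc.prems Suc.IH[of f e] closed by (simp add: m_assoc)
  also have "\<dots> = word_prod W (alternating n e f) \<otimes> e \<otimes> (e \<otimes> f) [^] Suc n"
    using Suc.prems closed comm by (simp add: m_assoc del: nat_pow_Suc)
  finally show ?case using Suc.prems by simp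
qed simp

lemma alternating_collapse:
  assumes "e \<in> S" "f \<in> S" and "word_prod W (alternating (Suc i) e f) = word_prod W (alternating i e f) \<otimes> e"
  shows "(e \<otimes> f) [^] Suc i = \<one>"
proof -
  have "word_prod W (alternating (Suc i) f e) \<otimes> (e \<otimes> f) [^] Suc i = word_prod W (alternating (Suc i) f e)"
    using assms(3) word_prod_alternating[OF assms(1,2), of "Suc i"] assms(1,2) by simp
  then show ?thesis using assms(1,2) by (simp add: r_cancel_one' del: alternating.simps nat_pow_Suc)
qed

lemma left_descent_exists:
  assumes "w \<in> carrier W" "w \<noteq> \<one>"
  shows "\<exists>s\<in>S. len w = len (s \<otimes> w) + 1"
proof -
  obtain ws where ws: "ws \<in> lists S" "word_prod W ws = w" "length ws = len w"
    using reduced_word_exists[OF assms(1)] .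
  then obtain s vs where ws_eq: "ws = s # vs" using assms(2) by (cases ws) auto
  have s: "s \<in> S" and vs: "vs \<in> lists S" using ws ws_eq by auto
  then have "s \<otimes> w = word_prod W vs" using ws ws_eq by auto
  then have "len (s \<otimes> w) < len w" using len_le[OF vs] ws ws_eq by simp
  then show ?thesis using len_mult_left[OF s assms(1)] s by auto
qed

lemma len_inv_mult_le:
  assumes "ws \<in> lists S" "w \<in> carrier W"
  shows "len (inv word_prod W ws \<otimes> w) \<le> length ws + len w"
  using assms(1)
proof (induction ws rule: rev_induct)
  case (snoc s ws)
  then have "inv word_prod W (ws @ [s]) \<otimes> w = s \<otimes> (inv word_prod W ws \<otimes> w)"
    using assms(2) by (simp add: inv_mult_group m_assoc)
  then show ?case using snoc assms(2) len_mult_left[of s "inv word_prod W ws \<otimes> w"] by auto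
qed (use assms(2) in simp)

end

section \<open>Right-angled Coxeter systems\<close>

locale right_angled_coxeter_system = coxeter_system +
  assumes right_angled_type: "right_angled W S"
begin

text \<open>If \<open>a b\<close> had infinite order, \<open>x\<close> would have reduced words with alternating suffixes in \<open>a\<close> and \<open>b\<close> of
  any length. Indeed, let \<open>e f \<dots> e f\<close> or \<open>f e \<dots> e f\<close> be such a suffix. As \<open>e\<close> is a right descent of
  \<open>x\<close>, exchange removes a letter of the word in favour of a new final \<open>e\<close>. A letter inside the suffix
  cannot be removed, since this gives \<open>(e f)\<^sup>i = \<one>\<close> for some \<open>i > 0\<close>; so the letter comes from the
  part in front of the suffix, and the suffix grows by one.\<close>

lemma right_descents_commute:
  assumes a: "a \<in> S" and b: "b \<in> S" and ne: "a \<noteq> b" and x: "x \<in> carrier W"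
    and da: "len (x \<otimes> a) < len x" and db: "len (x \<otimes> b) < len x"
  shows "a \<otimes> b = b \<otimes> a"
proof -
  have "ord (a \<otimes> b) \<noteq> 0"
  proof
    assume ord0: "ord (a \<otimes> b) = 0"
    have "ord (b \<otimes> a) = 0"
      using ord_inv[of "a \<otimes> b"] a b ord0 by (simp add: inv_mult_group)
    with ord0 have ord: "ord (e \<otimes> f) = 0" if "{e, f} = {a, b}" for e f
      using that by (auto simp: doubleton_eq_iff)
    have "\<exists>e f zs. {e, f} = {a, b} \<and> zs \<in> lists S \<and> word_prod W (zs @ alternating j e f) = x \<and>
        length zs + j = len x" for j
    proof (induction j)
      case 0
      obtain zs where "zs \<in> lists S" "word_prod W zs = x" "length zs = len x"
        using reduced_word_exists[OF x] .
      then have "{a, b} = {a, b} \<and> zs \<in> lists S \<and> word_prod W (zs @ alternating 0 a b) = x \<and>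
        length zs + 0 = len x" by simp
      then show ?case by blast
    next
      case (Suc j)
      then obtain e f zs where ef: "{e, f} = {a, b}" and zs: "zs \<in> lists S"
        and prod: "word_prod W (zs @ alternating j e f) = x" and l: "length zs + j = len x" by blast
      have e: "e \<in> S" and f: "f \<in> S" and de: "len (x \<otimes> e) < len x"
        using ef a b da db by (auto simp: doubleton_eq_iff)
      have "zs @ alternating j e f \<in> lists S" using zs e f by simp
      then obtain u c v where split: "zs @ alternating j e f = u @ c # v" and uv: "word_prod W (u @ v) = x \<otimes> e"
        using exchange[of "zs @ alternating j e f" x e] prod l e de by (metis length_alternating length_append)
      have ucv: "u \<in> lists S" "c \<in> S" "v \<in> lists S"
      proof -
        have "u @ c # v \<in> lists S" unfolding split[symmetric] using zs e f by simp
        then show "u \<in> lists S" "c \<in> S" "v \<in> lists S" by auto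
      qed
      from split consider z where "zs = u @ c # z" "v = z @ alternating j e f"
        | z where "u = zs @ z" "alternating j e f = z @ c # v"
        by (auto simp: append_eq_append_conv2 append_eq_Cons_conv)
      then show ?case
      proof cases
        case 1
        have "word_prod W ((u @ z) @ alternating (Suc j) f e) = word_prod W (u @ v) \<otimes> e"
          using 1 ucv e f by (simp add: m_assoc)
        also have "\<dots> = x" using uv x e by simp
        finally have "{f, e} = {a, b} \<and> u @ z \<in> lists S \<and>
          word_prod W ((u @ z) @ alternating (Suc j) f e) = x \<and> length (u @ z) + Suc j = len x"
          using ef 1 ucv l by auto
        then show ?thesis by blast
      next
        case 2
        have v: "v = alternating (length v) e f" using alternating_suffix[of j e f "z @ [c]" v] 2 by simp
        have cv: "c # v = alternating (Suc (length v)) e f" using alternating_suffix[of j e f z "c # v"] 2 by simp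
        have "word_prod W u \<otimes> word_prod W (c # v) = x"
          using prod split ucv by simp
        then have "word_prod W u \<otimes> word_prod W v = word_prod W u \<otimes> (word_prod W (c # v) \<otimes> e)"
          using uv ucv e by (simp add: m_assoc flip: \<open>word_prod W u \<otimes> word_prod W (c # v) = x\<close>)
        then have "word_prod W v = word_prod W (c # v) \<otimes> e" using ucv e by simp
        then have "word_prod W v \<otimes> e = word_prod W (c # v) \<otimes> e \<otimes> e" by (rule arg_cong)
        then have "word_prod W (c # v) = word_prod W v \<otimes> e" using ucv e by simp
        then have "word_prod W (alternating (Suc (length v)) e f) = word_prod W (alternating (length v) e f) \<otimes> e"
          by (simp only: v[symmetric] cv[symmetric])
        then have "(e \<otimes> f) [^] Suc (length v) = \<one>" by (rule alternating_collapse[OF e f])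
        moreover have "e \<otimes> f \<in> carrier W" using e f by simp
        ultimately have "ord (e \<otimes> f) dvd Suc (length v)" using pow_eq_id by blast
        then show ?thesis using ord[OF ef] by simp
      qed
    qed
    from this[of "Suc (len x)"] show False by auto
  qed
  then have "ord (a \<otimes> b) = 2"
    using right_angled_type[unfolded right_angled_def, THEN bspec, THEN bspec, THEN mp, OF a b ne] by simp
  then have "a \<otimes> b \<otimes> (a \<otimes> b) = \<one>"
    using pow_ord_eq_1[of "a \<otimes> b"] a b by (simp add: numeral_2_eq_2)
  then have "a \<otimes> b = inv (a \<otimes> b)" using a b by (simp add: inv_equality)
  then show ?thesis using a b by (simp add: inv_mult_group)
qed

lemma right_descents_len:
  assumes a: "a \<in> S" and b: "b \<in> S" and ne: "a \<noteq> b" and x: "x \<in> carrier W"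
    and da: "len (x \<otimes> a) < len x" and db: "len (x \<otimes> b) < len x"
  shows "len (x \<otimes> a \<otimes> b) + 2 = len x"
proof -
  obtain zs where zs: "zs \<in> lists S" "word_prod W zs = x \<otimes> a" "length zs = len (x \<otimes> a)"
    using reduced_word_exists[of "x \<otimes> a"] a x by auto
  have la: "len x = len (x \<otimes> a) + 1" using len_mult_right[OF a x] da by auto
  have prod: "word_prod W (zs @ [a]) = x" using zs a x by simp
  then obtain u c v where split: "zs @ [a] = u @ c # v" and uv: "word_prod W (u @ v) = x \<otimes> b"
    using exchange[of "zs @ [a]" x b] zs la a b prod db by auto
  have "len (x \<otimes> a \<otimes> b) + 2 \<le> len x"
  proof (cases v rule: rev_cases)
    case Nil
    then have "x \<otimes> a = x \<otimes> b" using split uv zs by auto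
    then show ?thesis using ne a b x by simp
  next
    case (snoc v' d)
    then have d: "d = a" and zs_eq: "zs = u @ c # v'" using split by auto
    have uv': "u @ v' \<in> lists S" using zs zs_eq by auto
    have "word_prod W (u @ v) = word_prod W (u @ v') \<otimes> a"
      using snoc d uv' a by (simp add: m_assoc)
    then have "word_prod W (u @ v') = x \<otimes> b \<otimes> a" using uv uv' a by simp
    also have "\<dots> = x \<otimes> a \<otimes> b"
      using right_descents_commute[OF assms] a b x by (simp add: m_assoc)
    finally show ?thesis using len_le[OF uv'] zs zs_eq la by simp
  qed
  then show ?thesis using len_mult_right[of b "x \<otimes> a"] la a b x by auto
qed

lemma left_descents:
  assumes a: "a \<in> S" and b: "b \<in> S" and ne: "a \<noteq> b" and x: "x \<in> carrier W"
    and da: "len (a \<otimes> x) < len x" and db: "len (b \<otimes> x) < len x"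
  shows "a \<otimes> b = b \<otimes> a" "len (b \<otimes> (a \<otimes> x)) + 2 = len x"
proof -
  have inv: "len (inv x \<otimes> t) = len (t \<otimes> x)" if "t \<in> S" for t
    using len_inv[of "t \<otimes> x"] that x by (simp add: inv_mult_group)
  have "len (inv x \<otimes> a) < len (inv x)" "len (inv x \<otimes> b) < len (inv x)"
    using da db inv a b x by auto
  note * = a b ne inv_closed[OF x] this
  show "a \<otimes> b = b \<otimes> a" by (rule right_descents_commute[OF *])
  have "len (inv x \<otimes> a \<otimes> b) = len (b \<otimes> (a \<otimes> x))"
    using len_inv[of "b \<otimes> (a \<otimes> x)"] a b x by (simp add: inv_mult_group m_assoc)
  then show "len (b \<otimes> (a \<otimes> x)) + 2 = len x" using right_descents_len[OF *] x by simp
qed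

text \<open>Let \<open>a\<close> be the last letter of a reduced word for \<open>v\<close>. Both \<open>a\<close> and \<open>r\<close> are right descents of
  \<open>s v = v r\<close>, hence they commute, and the relation persists when \<open>a\<close> is removed from \<open>v\<close>. In the end
  \<open>s = r\<close>, so all the removed letters commute with \<open>s\<close>.\<close>

lemma conjugate_generators:
  assumes s: "s \<in> S" and r: "r \<in> S" and v: "v \<in> carrier W"
    and up: "len (s \<otimes> v) = len v + 1" and conj: "s \<otimes> v = v \<otimes> r"
  shows "r = s \<and> (\<exists>vs \<in> lists {t \<in> S - {s}. t \<otimes> s = s \<otimes> t}. word_prod W vs = v \<and> length vs = len v)"
  using v up conj
proof (induction "len v" arbitrary: v)
  case 0
  then have "v = \<one>" using len_eq_0 by simp
  moreover have "word_prod W [] = \<one>" "[] \<in> lists {t \<in> S - {s}. t \<otimes> s = s \<otimes> t}" by auto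
  ultimately show ?case using 0 s r by (metis S_closed l_one len_one list.size(3) r_one)
next
  case (Suc k)
  note v = \<open>v \<in> carrier W\<close>
  obtain ws where ws: "ws \<in> lists S" "word_prod W ws = v" "length ws = len v"
    using reduced_word_exists[OF v] .
  then obtain us a where ws_eq: "ws = us @ [a]" using Suc.hyps(2) by (cases ws rule: rev_cases) auto
  define u where "u = word_prod W us"
  have a: "a \<in> S" and u: "u \<in> carrier W" and va: "v = u \<otimes> a" 
    using ws ws_eq by (auto simp: u_def)
  have "len u \<le> k" using len_le[of us] ws ws_eq Suc.hyps(2) by (simp add: u_def)
  then have lu: "len u = k" using len_mult_right[OF a u] Suc.hyps(2) va by auto
  have xa: "s \<otimes> v \<otimes> a = s \<otimes> u" using va a u s by (simp add: m_assoc)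
  have lx: "len (s \<otimes> v) = k + 2" using Suc by simp
  have "len (s \<otimes> u) \<le> k + 1" using len_mult_left[OF s u] lu by auto
  then have da: "len (s \<otimes> v \<otimes> a) < len (s \<otimes> v)" using xa lx by simp
  have lsu: "len (s \<otimes> u) = len u + 1"
    using len_mult_right[OF a, of "s \<otimes> v"] lx xa lu da s v by auto
  have xr: "s \<otimes> v \<otimes> r = v" using Suc.prems r v by simp
  then have dr: "len (s \<otimes> v \<otimes> r) < len (s \<otimes> v)" using lx Suc.hyps by simp
  have "a \<noteq> r"
  proof
    assume "a = r"
    then have "s \<otimes> v = u" using Suc.prems va a u by simp
    then show False using lx lu by simp
  qed
  have x: "s \<otimes> v \<in> carrier W" using s v by simp
  have comm: "a \<otimes> r = r \<otimes> a" by (rule right_descents_commute[OF a r \<open>a \<noteq> r\<close> x da dr])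
  have "s \<otimes> u \<otimes> r = s \<otimes> v \<otimes> (a \<otimes> r)" using xa a r x by (simp flip: m_assoc)
  also have "\<dots> = s \<otimes> v \<otimes> r \<otimes> a" using comm a r x by (simp add: m_assoc)
  also have "\<dots> = u" using xr va a u by simp
  finally have "s \<otimes> u \<otimes> r \<otimes> r = u \<otimes> r" by simp
  then have "s \<otimes> u = u \<otimes> r" using s u r by simp
  then obtain vs where "r = s" and vs: "vs \<in> lists {t \<in> S - {s}. t \<otimes> s = s \<otimes> t}"
    "word_prod W vs = u" "length vs = len u"
    using Suc.hyps(1)[of u] lu u lsu by auto
  have "vs \<in> lists S" using vs by auto
  then have "vs @ [a] \<in> lists {t \<in> S - {s}. t \<otimes> s = s \<otimes> t}" "word_prod W (vs @ [a]) = v"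
    "length (vs @ [a]) = len v"
    using vs comm a \<open>a \<noteq> r\<close> \<open>r = s\<close> va lu Suc.hyps by auto
  then show ?case using \<open>r = s\<close> by blast
qed

end

section \<open>Weyl distance, panels and residues\<close>

context building
begin

lemma adjacent_sym:
  assumes "c \<in> Ch" "d \<in> Ch" "s \<in> S" "\<delta> c d = s"
  shows "\<delta> d c = s"
proof -
  obtain c' where c': "c' \<in> Ch" "\<delta> c' c = s" "\<delta> c' d = s \<otimes> \<delta> c d"
    using \<delta>_step_ex[of c d s] assms by auto
  then have "c' = d" using \<delta>_eq_one_iff[of c' d] assms by simp
  then show ?thesis using c' by simp
qed

text \<open>For \<open>e = c\<close> the conclusion is \<open>\<delta> d c = inv (\<delta> c d)\<close>. The chamber \<open>e\<close> is separate because it stays in place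
  while the induction moves \<open>c\<close> towards \<open>d\<close>.\<close>

lemma \<delta>_along_reduced_word:
  assumes "ws \<in> lists S" "length ws = len (word_prod W ws)"
    and "c \<in> Ch" "d \<in> Ch" "e \<in> Ch" "\<delta> c d = word_prod W ws"
    and "len (inv word_prod W ws \<otimes> \<delta> c e) = length ws + len (\<delta> c e)"
  shows "\<delta> d e = inv word_prod W ws \<otimes> \<delta> c e"
  using assms
proof (induction ws arbitrary: c rule: list.induct)
  case Nil
  then have "c = d" using \<delta>_eq_one_iff by simp
  then show ?case using Nil \<delta>_closed by simp
next
  case (Cons s vs)
  have s: "s \<in> S" and vs: "vs \<in> lists S" using Cons.prems by auto
  have v: "word_prod W vs \<in> carrier W" using vs by simp
  have ce: "\<delta> c e \<in> carrier W" using Cons.prems \<delta>_closed by simp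
  obtain c' where c': "c' \<in> Ch" "\<delta> c' c = s" "\<delta> c' d = s \<otimes> \<delta> c d"
    using \<delta>_step_ex[of c d s] Cons.prems s by auto
  have c'd: "\<delta> c' d = word_prod W vs" using c' Cons.prems s v by simp
  have red: "length vs = len (word_prod W vs)"
    using Cons.prems(2) len_mult_left[OF s v] len_le[OF vs] by auto
  have eq: "inv word_prod W (s # vs) \<otimes> \<delta> c e = inv word_prod W vs \<otimes> (s \<otimes> \<delta> c e)"
    using s v ce by (simp add: inv_mult_group m_assoc)
  have "length vs + len (s \<otimes> \<delta> c e) \<ge> length (s # vs) + len (\<delta> c e)"
    using len_inv_mult_le[OF vs, of "s \<otimes> \<delta> c e"] s ce Cons.prems(7) eq by simp
  then have up: "len (s \<otimes> \<delta> c e) = len (\<delta> c e) + 1" using len_mult_left[OF s ce] by auto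
  then have c'e: "\<delta> c' e = s \<otimes> \<delta> c e"
    using \<delta>_step_up[of c e c' s] c' Cons.prems s by simp
  have "len (inv word_prod W vs \<otimes> \<delta> c' e) = length vs + len (\<delta> c' e)"
    using Cons.prems(7) eq c'e up by simp
  then have "\<delta> d e = inv word_prod W vs \<otimes> \<delta> c' e"
    using Cons.IH[of c'] vs red c' c'd Cons.prems by blast
  then show ?case using c'e eq by simp
qed

lemma \<delta>_inverse:
  assumes "c \<in> Ch" "d \<in> Ch" shows "\<delta> d c = inv (\<delta> c d)"
proof -
  obtain ws where ws: "ws \<in> lists S" "word_prod W ws = \<delta> c d" "length ws = len (\<delta> c d)"
    using reduced_word_exists[OF \<delta>_closed[OF assms]] .
  have cc: "\<delta> c c = \<one>" using \<delta>_eq_one_iff[of c c] assms by blast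
  have w: "\<delta> c d \<in> carrier W" using \<delta>_closed assms by blast
  have "\<delta> d c = inv word_prod W ws \<otimes> \<delta> c c"
  proof (rule \<delta>_along_reduced_word)
    show "len (inv word_prod W ws \<otimes> \<delta> c c) = length ws + len (\<delta> c c)"
      unfolding cc ws(2,3) using w by simp
  qed (use ws assms in simp_all)
  then show ?thesis unfolding cc ws(2) using w by simp
qed

lemma \<delta>_step_right:
  assumes "c \<in> Ch" "d \<in> Ch" "d' \<in> Ch" "s \<in> S" "\<delta> d d' = s"
  shows "\<delta> c d' = \<delta> c d \<otimes> s \<or> \<delta> c d' = \<delta> c d"
proof -
  have "\<delta> d' d = s" using adjacent_sym assms by blast
  then have "\<delta> d' c = s \<otimes> \<delta> d c \<or> \<delta> d' c = \<delta> d c" using \<delta>_step[of d c d' s] assms by blast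
  moreover have "\<delta> c d' = inv (\<delta> d' c)" "\<delta> c d = inv (\<delta> d c)" "\<delta> d c \<in> carrier W"
    using \<delta>_inverse \<delta>_closed assms by blast+
  ultimately show ?thesis using assms(4) by (auto simp: inv_mult_group)
qed

text \<open>A geodesic gallery from \<open>x\<close> to \<open>y\<close> has a reduced type, and the distance between the ends of a gallery of
  reduced type is the product of its letters, wherever the gallery lies.\<close>

lemma adjacency_preserving_imp_isometry:
  assumes f: "f \<in> Ch \<rightarrow> Ch"
    and adj: "\<And>x y. x \<in> Ch \<Longrightarrow> y \<in> Ch \<Longrightarrow> \<delta> x y \<in> S \<Longrightarrow> \<delta> (f x) (f y) = \<delta> x y"
    and "x \<in> Ch" "y \<in> Ch"
  shows "\<delta> (f x) (f y) = \<delta> x y"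
  using assms(3,4)
proof (induction "len (\<delta> x y)" arbitrary: x)
  case 0
  then have "x = y" using len_eq_0 \<delta>_eq_one_iff \<delta>_closed by metis
  moreover have "f y \<in> Ch" using f 0 by blast
  ultimately show ?case using 0 \<delta>_eq_one_iff[of "f y" "f y"] \<delta>_eq_one_iff[of y y] by simp
next
  case (Suc k)
  have w: "\<delta> x y \<in> carrier W" using Suc.prems \<delta>_closed by simp
  have "\<delta> x y \<noteq> \<one>" using Suc.hyps(2) by auto
  then obtain s where s: "s \<in> S" "len (\<delta> x y) = len (s \<otimes> \<delta> x y) + 1"
    using left_descent_exists[OF w] by blast
  obtain z where z: "z \<in> Ch" "\<delta> z x = s" "\<delta> z y = s \<otimes> \<delta> x y"
    using \<delta>_step_ex Suc.prems s(1) by blast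
  have "\<delta> (f z) (f y) = s \<otimes> \<delta> x y" using Suc.hyps(1)[of z] z s Suc.hyps(2) Suc.prems by simp
  moreover have "\<delta> (f x) (f z) = s"
    using adj[of x z] adjacent_sym[of z x s] z Suc.prems s by simp
  ultimately have "\<delta> (f x) (f y) = s \<otimes> (s \<otimes> \<delta> x y)"
    using \<delta>_step_up[of "f z" "f y" "f x" s] f z Suc.prems s w by (auto simp: Pi_iff)
  then show ?case using s w by simp
qed

abbreviation pan :: "'a \<Rightarrow> 'c \<Rightarrow> 'c set" where "pan \<equiv> panel Ch \<delta>"

lemma panel_subset: "pan s c \<subseteq> Ch"
  by (auto simp: panel_def)

lemma self_in_panel: "c \<in> Ch \<Longrightarrow> c \<in> pan s c"
  by (simp add: panel_def)

lemma panel_adjacent: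
  assumes "c \<in> Ch" "s \<in> S" "x \<in> pan s c" "y \<in> pan s c" "x \<noteq> y"
  shows "\<delta> x y = s"
proof -
  have Ch: "x \<in> Ch" "y \<in> Ch" using assms panel_subset by auto
  show ?thesis
  proof (cases "x = c \<or> y = c")
    case True
    then show ?thesis
      using assms(3-5) adjacent_sym[OF assms(1) Ch(1) assms(2)] by (auto simp: panel_def)
  next
    case False
    then have xc: "\<delta> x c = s" and cy: "\<delta> c y = s"
      using assms(3,4) adjacent_sym[OF assms(1) Ch(1) assms(2)] by (auto simp: panel_def)
    then have "\<delta> x y = s \<otimes> s \<or> \<delta> x y = s"
      using \<delta>_step[of c y x s] assms Ch by auto
    then show ?thesis using \<delta>_eq_one_iff[OF Ch] assms by auto
  qed
qed

lemma panel_eq: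
  assumes "c \<in> Ch" "s \<in> S" "d \<in> pan s c"
  shows "pan s d = pan s c"
proof -
  have d: "d \<in> Ch" using assms panel_subset by auto
  have cd: "c \<in> pan s d" using panel_adjacent[OF assms(1,2,3) self_in_panel[OF assms(1)]] assms(1) 
    by (auto simp: panel_def)
  have "x \<in> pan s d" if "x \<in> pan s c" for x
    using panel_adjacent[OF assms(1,2,3) that] that panel_subset by (auto simp: panel_def)
  moreover have "x \<in> pan s c" if "x \<in> pan s d" for x
    using panel_adjacent[OF d assms(2) cd that] that panel_subset by (auto simp: panel_def)
  ultimately show ?thesis by blast
qed

text \<open>The chambers whose projection to the \<open>s\<close>-panel of \<open>c\<close> is \<open>c\<close>, expressed by the distance growing when one
  first crosses this panel.\<close>

definition wing :: "'a \<Rightarrow> 'c \<Rightarrow> 'c set" where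
  "wing s c = {e \<in> Ch. len (s \<otimes> \<delta> c e) = len (\<delta> c e) + 1}"

lemma wing_subset: "wing s c \<subseteq> Ch"
  by (auto simp: wing_def)

lemma not_in_wing:
  assumes "c \<in> Ch" "e \<in> Ch" "s \<in> S"
  shows "e \<notin> wing s c \<longleftrightarrow> len (\<delta> c e) = len (s \<otimes> \<delta> c e) + 1"
proof -
  have "e \<in> wing s c \<longleftrightarrow> len (s \<otimes> \<delta> c e) = len (\<delta> c e) + 1"
    unfolding wing_def using assms(2) by blast
  then show ?thesis using len_mult_left[OF assms(3) \<delta>_closed[OF assms(1,2)]] by linarith
qed

lemma \<delta>_other_in_panel:
  assumes "c \<in> Ch" "s \<in> S" "d \<in> pan s c" "d \<noteq> c" "e \<in> wing s c"
  shows "\<delta> d e = s \<otimes> \<delta> c e"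
proof -
  have d: "d \<in> Ch" using assms panel_subset by auto
  have "\<delta> d c = s" using panel_adjacent[OF assms(1,2,3) self_in_panel] assms by simp
  then show ?thesis using \<delta>_step_up[of c e d s] assms d by (auto simp: wing_def)
qed

lemma wing_disjoint:
  assumes "c \<in> Ch" "s \<in> S" "p \<in> pan s c" "q \<in> pan s c" "p \<noteq> q"
  shows "wing s p \<inter> wing s q = {}"
proof -
  have pq: "p \<in> Ch" "q \<in> pan s p" "q \<in> Ch" using panel_eq[OF assms(1,2,3)] assms panel_subset by auto
  have "e \<notin> wing s q" if e: "e \<in> wing s p" for e
  proof -
    have "e \<in> Ch" using e wing_subset by auto
    moreover have "\<delta> q e = s \<otimes> \<delta> p e" using \<delta>_other_in_panel[OF pq(1) assms(2) pq(2)] assms e by auto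
    moreover have "len (s \<otimes> \<delta> p e) = len (\<delta> p e) + 1" using e by (simp add: wing_def)
    ultimately show ?thesis
      using not_in_wing[OF pq(3)] assms(2) \<delta>_closed[OF pq(1)] by simp
  qed
  then show ?thesis by auto
qed

lemma wing_cover:
  assumes "c \<in> Ch" "s \<in> S" "e \<in> Ch"
  obtains p where "p \<in> pan s c" "e \<in> wing s p"
proof (cases "e \<in> wing s c")
  case True
  then show ?thesis using that self_in_panel assms by blast
next
  case False
  obtain p where p: "p \<in> Ch" "\<delta> p c = s" "\<delta> p e = s \<otimes> \<delta> c e"
    using \<delta>_step_ex assms by blast
  have "p \<in> pan s c" using p adjacent_sym[OF p(1) assms(1,2)] by (auto simp: panel_def)
  moreover have "e \<in> wing s p"
    using False not_in_wing[OF assms(1,3,2)] assms(2,3) p(3) \<delta>_closed[OF assms(1,3)]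
    by (simp add: wing_def)
  ultimately show ?thesis using that by blast
qed

abbreviation res :: "'a set \<Rightarrow> 'c \<Rightarrow> 'c set" where "res \<equiv> residue Ch \<delta>"

lemma word_in_residue:
  assumes "c \<in> Ch" "d \<in> Ch" "K \<subseteq> S" "vs \<in> lists K" "word_prod W vs = \<delta> c d"
  shows "d \<in> res K c"
  using assms
proof (induction vs arbitrary: c rule: list.induct)
  case Nil
  then have "c = d" using \<delta>_eq_one_iff[of c d] by simp
  then show ?case by (simp add: residue_def)
next
  case (Cons s vs)
  have s: "s \<in> K" "s \<in> S" and vs: "vs \<in> lists K" using Cons.prems by auto
  obtain c' where c': "c' \<in> Ch" "\<delta> c' c = s" "\<delta> c' d = s \<otimes> \<delta> c d"
    using \<delta>_step_ex[of c d s] Cons.prems s by auto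
  have "word_prod W vs \<in> carrier W" using vs Cons.prems(3) by (simp add: subset_trans)
  moreover have "\<delta> c' d = s \<otimes> (s \<otimes> word_prod W vs)"
    unfolding c'(3) Cons.prems(5)[symmetric] by simp
  ultimately have "word_prod W vs = \<delta> c' d" using s by simp
  then have "d \<in> res K c'" by (rule Cons.IH[OF c'(1) Cons.prems(2,3) vs])
  moreover have "\<delta> c c' = s" using adjacent_sym[OF c'(1) Cons.prems(1) s(2) c'(2)] .
  then have "(c, c') \<in> {(x, y). x \<in> Ch \<and> y \<in> Ch \<and> \<delta> x y \<in> K}"
    using Cons.prems(1) c'(1) s(1) by simp
  ultimately show ?case unfolding residue_def mem_Collect_eq
    by (blast intro: converse_rtrancl_into_rtrancl)
qed

lemma residue_subset:
  assumes "c \<in> Ch" shows "res K c \<subseteq> Ch"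
proof
  fix d assume "d \<in> res K c"
  then have "(c, d) \<in> {(x, y). x \<in> Ch \<and> y \<in> Ch \<and> \<delta> x y \<in> K}\<^sup>*" by (simp add: residue_def)
  then show "d \<in> Ch" by (rule rtranclE) (use assms in simp_all)
qed

lemma residue_trans: "d \<in> res K c \<Longrightarrow> e \<in> res K d \<Longrightarrow> e \<in> res K c"
  unfolding residue_def mem_Collect_eq by (rule rtrancl_trans)

lemma residue_mono: "K \<subseteq> L \<Longrightarrow> res K c \<subseteq> res L c"
proof -
  assume "K \<subseteq> L"
  then have "{(x, y). x \<in> Ch \<and> y \<in> Ch \<and> \<delta> x y \<in> K} \<subseteq> {(x, y). x \<in> Ch \<and> y \<in> Ch \<and> \<delta> x y \<in> L}" by blast
  from rtrancl_mono[OF this] show ?thesis unfolding residue_def by blast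
qed

lemma panel_in_residue:
  assumes "c \<in> Ch" "s \<in> K" shows "pan s c \<subseteq> res K c"
proof
  fix d assume "d \<in> pan s c"
  then have "d = c \<or> (c, d) \<in> {(x, y). x \<in> Ch \<and> y \<in> Ch \<and> \<delta> x y \<in> K}"
    using assms by (auto simp: panel_def)
  then show "d \<in> res K c"
  proof
    assume "(c, d) \<in> {(x, y). x \<in> Ch \<and> y \<in> Ch \<and> \<delta> x y \<in> K}"
    from r_into_rtrancl[OF this] show ?thesis by (simp add: residue_def)
  qed (simp add: residue_def)
qed

text \<open>The residues of type \<open>insert s (perp s)\<close> are those that carry the \<open>s\<close>-tree-walls.\<close>

definition perp :: "'a \<Rightarrow> 'a set" where
  "perp s = {t \<in> S - {s}. t \<otimes> s = s \<otimes> t}"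

end

section \<open>Wings\<close>

locale right_angled_building = building + right_angled_coxeter_system
begin

text \<open>Write \<open>v = \<delta> p e\<close>. Since \<open>e\<close> and \<open>e'\<close> are adjacent and project to different chambers, passing from \<open>v\<close>
  to \<open>s v r\<close> does not change the length. Folding gives \<open>s v = v r\<close>, and then \<open>r = s\<close> and \<open>v\<close> is a
  product of generators that commute with \<open>s\<close> and differ from it.\<close>

lemma wing_boundary:
  assumes c: "c \<in> Ch" and s: "s \<in> S" and r: "r \<in> S"
    and p: "p \<in> pan s c" and q: "q \<in> pan s c" and ne: "p \<noteq> q"
    and e: "e \<in> wing s p" and e': "e' \<in> wing s q" and adj: "\<delta> e e' = r"
  shows "r = s" "s \<otimes> \<delta> p e = \<delta> p e \<otimes> s" "e \<in> res (perp s) p"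
proof -
  have Ch: "p \<in> Ch" "q \<in> Ch" "e \<in> Ch" "e' \<in> Ch"
    using p q e e' panel_subset wing_subset[of s p] wing_subset[of s q] by auto
  define v where "v = \<delta> p e"
  have v: "v \<in> carrier W" using Ch \<delta>_closed by (simp add: v_def)
  have qp: "q \<in> pan s p" "p \<in> pan s q" using panel_eq[OF c s] p q by auto
  have qe: "\<delta> q e = s \<otimes> v"
    using \<delta>_other_in_panel[OF Ch(1) s qp(1)] ne e by (simp add: v_def)
  have pe': "\<delta> p e' = s \<otimes> \<delta> q e'"
    using \<delta>_other_in_panel[OF Ch(2) s qp(2)] ne e' by simp
  have lv: "len (s \<otimes> v) = len v + 1" using e by (simp add: wing_def v_def)
  have lq: "len (s \<otimes> \<delta> q e') = len (\<delta> q e') + 1" using e' by (simp add: wing_def)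
  have "\<delta> q e' \<noteq> s \<otimes> v" using lq lv s v by auto
  then have qe': "\<delta> q e' = s \<otimes> v \<otimes> r"
    using \<delta>_step_right[OF Ch(2,3,4) r adj] qe by auto
  then have "len (v \<otimes> r) = len (s \<otimes> v \<otimes> r) + 1" using lq s v r by (simp add: m_assoc)
  moreover have "len (v \<otimes> r) = len v + 1 \<or> len v = len (v \<otimes> r) + 1" by (rule len_mult_right[OF r v])
  moreover have "len (s \<otimes> v \<otimes> r) = len (s \<otimes> v) + 1 \<or> len (s \<otimes> v) = len (s \<otimes> v \<otimes> r) + 1"
    by (rule len_mult_right[OF r]) (use s v in simp)
  ultimately have up: "len (v \<otimes> r) = len v + 1" and down: "len (s \<otimes> v \<otimes> r) < len v + 2"
    using lv by linarith+
  have conj: "s \<otimes> v = v \<otimes> r" by (rule folding[OF s r v lv up down])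
  show "r = s" using conjugate_generators[OF s r v lv conj] by simp
  then show "s \<otimes> \<delta> p e = \<delta> p e \<otimes> s" using conj by (simp add: v_def)
  obtain vs where "vs \<in> lists (perp s)" "word_prod W vs = v"
    using conjugate_generators[OF s r v lv conj] by (auto simp: perp_def)
  then show "e \<in> res (perp s) p"
    using word_in_residue[of p e "perp s" vs] Ch by (auto simp: v_def perp_def)
qed

lemma perp_subset: "perp s \<subseteq> S - {s}"
  by (auto simp: perp_def)

lemma wing_adjacent_closed:
  assumes c: "c \<in> Ch" and s: "s \<in> S" and r: "r \<in> S" "r \<noteq> s"
    and e: "e \<in> wing s c" and e': "e' \<in> Ch" and adj: "\<delta> e e' = r"
  shows "e' \<in> wing s c"
proof (rule ccontr)
  assume not: "e' \<notin> wing s c"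
  obtain q where q: "q \<in> pan s c" "e' \<in> wing s q" using wing_cover[OF c s e'] .
  then have "c \<noteq> q" using not by auto
  then have "r = s"
    using wing_boundary(1)[OF c s r(1) self_in_panel[OF c] q(1) _ e q(2) adj] by simp
  then show False using r by simp
qed

lemma wing_residue_closed:
  assumes c: "c \<in> Ch" and s: "s \<in> S" and K: "K \<subseteq> S - {s}" and e: "e \<in> Ch" and d: "d \<in> res K e"
  shows "d \<in> wing s c \<longleftrightarrow> e \<in> wing s c"
proof -
  have "(e, d) \<in> {(x, y). x \<in> Ch \<and> y \<in> Ch \<and> \<delta> x y \<in> K}\<^sup>*" using d by (simp add: residue_def)
  then show ?thesis
  proof (induction rule: rtrancl_induct)
    case (step y z)
    then have yz: "y \<in> Ch" "z \<in> Ch" "\<delta> y z \<in> S" "\<delta> y z \<noteq> s" using K by auto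
    then have zy: "\<delta> z y = \<delta> y z" using adjacent_sym[of y z "\<delta> y z"] by simp
    have "z \<in> wing s c \<longleftrightarrow> y \<in> wing s c"
      using wing_adjacent_closed[OF c s yz(3,4) _ yz(2) refl]
        wing_adjacent_closed[OF c s yz(3,4) _ yz(1) zy] by blast
    then show ?case using step.IH by simp
  qed simp
qed

text \<open>A geodesic gallery from \<open>c'\<close> to a chamber of \<open>wing t c'\<close> stays in that wing. If it entered \<open>wing t c\<close>
  at \<open>e\<close>, then \<open>wing_boundary\<close> would join \<open>c\<close> and \<open>e\<close> by a gallery of type \<open>perp t\<close>. Such a
  gallery cannot leave \<open>wing t c'\<close>, so \<open>c\<close> would lie in it.\<close>

lemma opposite_wings_disjoint:
  assumes c: "c \<in> Ch" and c': "c' \<in> Ch" and t: "t \<in> S"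
    and out: "c' \<notin> wing t c" "c \<notin> wing t c'"
  shows "wing t c \<inter> wing t c' = {}"
proof -
  have "e \<notin> wing t c" if "e \<in> wing t c'" for e
    using that
  proof (induction "len (\<delta> e c')" arbitrary: e)
    case 0
    then have e: "e \<in> Ch" using wing_subset by auto
    then have "\<delta> e c' = \<one>" using len_eq_0[OF \<delta>_closed[OF e c']] 0 by simp
    then have "e = c'" using \<delta>_eq_one_iff[OF e c'] by simp
    then show ?case using out by simp
  next
    case (Suc k)
    then have e: "e \<in> Ch" using wing_subset by auto
    have w: "\<delta> e c' \<in> carrier W" using \<delta>_closed[OF e c'] .
    have "\<delta> e c' \<noteq> \<one>" using Suc.hyps(2) by auto
    then obtain r where r: "r \<in> S" "len (\<delta> e c') = len (r \<otimes> \<delta> e c') + 1"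
      using left_descent_exists[OF w] by blast
    obtain e1 where e1: "e1 \<in> Ch" "\<delta> e1 e = r" "\<delta> e1 c' = r \<otimes> \<delta> e c'"
      using \<delta>_step_ex[OF e c' r(1)] by blast
    have k: "k = len (\<delta> e1 c')" using Suc.hyps(2) r e1 by simp
    have len1: "len (\<delta> c' e1) = k" "len (\<delta> c' e) = k + 1"
      using k Suc.hyps(2) \<delta>_inverse[OF e1(1) c'] \<delta>_inverse[OF e c'] \<delta>_closed[OF e1(1) c'] w by auto
    have w1: "\<delta> c' e1 \<in> carrier W" using \<delta>_closed[OF c' e1(1)] .
    have ee1: "\<delta> e e1 = r" using adjacent_sym[OF e1(1) e r(1) e1(2)] .
    have e1_in: "e1 \<in> wing t c'"
    proof (rule ccontr)
      assume "e1 \<notin> wing t c'"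
      then have l1: "len (t \<otimes> \<delta> c' e1) + 1 = k" using not_in_wing[OF c' e1(1) t] len1 by simp
      have "\<delta> c' e = \<delta> c' e1 \<otimes> r \<or> \<delta> c' e = \<delta> c' e1"
        by (rule \<delta>_step_right[OF c' e1(1) e r(1) e1(2)])
      moreover have "len (t \<otimes> \<delta> c' e1 \<otimes> r) = len (t \<otimes> \<delta> c' e1) + 1 \<or>
          len (t \<otimes> \<delta> c' e1) = len (t \<otimes> \<delta> c' e1 \<otimes> r) + 1"
        by (rule len_mult_right[OF r(1)]) (use t w1 in simp)
      then have "len (t \<otimes> \<delta> c' e1 \<otimes> r) \<le> len (t \<otimes> \<delta> c' e1) + 1" by linarith
      then have "len (t \<otimes> (\<delta> c' e1 \<otimes> r)) \<le> len (t \<otimes> \<delta> c' e1) + 1"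
        using t r(1) w1 by (simp add: m_assoc)
      ultimately have "len (t \<otimes> \<delta> c' e) \<le> len (t \<otimes> \<delta> c' e1) + 1" by auto
      moreover have "len (t \<otimes> \<delta> c' e) = len (\<delta> c' e) + 1" using Suc.prems by (simp add: wing_def)
      ultimately show False using len1 l1 by simp
    qed
    then have not: "e1 \<notin> wing t c" using Suc.hyps(1) k by simp
    show ?case
    proof
      assume e_in: "e \<in> wing t c"
      obtain p where p: "p \<in> pan t c" "e1 \<in> wing t p" using wing_cover[OF c t e1(1)] .
      then have "c \<noteq> p" using not by auto
      then have "e \<in> res (perp t) c"
        using wing_boundary(3)[OF c t r(1) self_in_panel[OF c] p(1) _ e_in p(2) ee1] by simp
      then have "c \<in> wing t c'"
        using wing_residue_closed[OF c' t perp_subset c] Suc.prems by simp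
      then show False using out by simp
    qed
  qed
  then show ?thesis by blast
qed

text \<open>Choose \<open>t\<close> such that \<open>n c\<close> is not in \<open>wing t c\<close>. If also \<open>c\<close> is not in \<open>wing t (n c)\<close>, the wing of
  \<open>c\<close> is moved off itself. Otherwise the wing of another chamber \<open>d\<close> of the panel works, provided that
  \<open>d\<close> is neither \<open>c\<close> nor the projection of \<open>n c\<close>.\<close>

lemma moved_wing_exists:
  assumes iso: "n \<in> Ch \<rightarrow> Ch" "\<And>x y. x \<in> Ch \<Longrightarrow> y \<in> Ch \<Longrightarrow> \<delta> (n x) (n y) = \<delta> x y"
    and thick: "\<And>t a b. t \<in> S \<Longrightarrow> \<exists>d\<in>pan t c. d \<noteq> a \<and> d \<noteq> b"
    and c: "c \<in> Ch" and moved: "n c \<noteq> c"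
  shows "\<exists>t\<in>S. \<exists>d\<in>Ch. \<forall>e\<in>wing t d. n e \<notin> wing t d"
proof -
  have nc: "n c \<in> Ch" using iso c by auto
  define w where "w = \<delta> c (n c)"
  have w: "w \<in> carrier W" using \<delta>_closed[OF c nc] by (simp add: w_def)
  have "w \<noteq> \<one>" using \<delta>_eq_one_iff[OF c nc] moved by (simp add: w_def)
  then obtain t where t: "t \<in> S" "len w = len (t \<otimes> w) + 1" using left_descent_exists[OF w] by blast
  have nc_out: "n c \<notin> wing t c" using not_in_wing[OF c nc t(1)] t(2) by (simp add: w_def)
  have image: "n e \<in> wing t (n d)" if "e \<in> wing t d" "d \<in> Ch" for e d
    using that iso wing_subset[of t d] by (auto simp: wing_def)
  have *: "\<forall>e\<in>wing t d. n e \<notin> wing t d"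
    if d: "d \<in> Ch" "n d \<notin> wing t d" "d \<notin> wing t (n d)" for d
  proof -
    have "n d \<in> Ch" using iso d by auto
    then have "wing t d \<inter> wing t (n d) = {}" using opposite_wings_disjoint[OF d(1) _ t(1) d(2,3)] by simp
    then show ?thesis using image d by blast
  qed
  show ?thesis
  proof (cases "c \<in> wing t (n c)")
    case False
    then show ?thesis using * c nc_out t(1) by blast
  next
    case True
    have winv: "\<delta> (n c) c = inv w" using \<delta>_inverse[OF c nc] by (simp add: w_def)
    \<comment> \<open>If \<open>d\<close> and \<open>n d\<close> were not in opposite position, \<open>wing_boundary\<close> would make \<open>t\<close> commute with \<open>w\<close>.\<close>
    have no_comm: "t \<otimes> w \<noteq> w \<otimes> t"
    proof
      assume "t \<otimes> w = w \<otimes> t"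
      moreover have "len (t \<otimes> inv w) = len w + 1" using True winv w by (simp add: wing_def)
      moreover have "len (t \<otimes> inv w) = len (w \<otimes> t)"
        using len_inv[of "w \<otimes> t"] w t(1) by (simp add: inv_mult_group)
      ultimately show False using t(2) by simp
    qed
    obtain p where p: "p \<in> pan t c" "n c \<in> wing t p" using wing_cover[OF c t(1) nc] .
    have p_ne: "p \<noteq> c" using p nc_out by auto
    obtain d where d: "d \<in> pan t c" "d \<noteq> c" "d \<noteq> p" using thick[OF t(1)] by blast
    have dCh: "d \<in> Ch" "p \<in> Ch" using d p panel_subset by auto
    have cd: "\<delta> c d = t" using panel_adjacent[OF c t(1) self_in_panel[OF c] d(1)] d(2) by simp
    have nd: "n d \<in> Ch" "\<delta> (n c) (n d) = t" using iso dCh c cd by auto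
    have "n d \<noteq> n c" using \<delta>_eq_one_iff[OF nc nd(1)] nd(2) t(1) S_neq_one by metis
    have d_out: "d \<notin> wing t (n d)"
    proof
      assume "d \<in> wing t (n d)"
      moreover have "n d \<in> pan t (n c)" using nd by (simp add: panel_def)
      ultimately have "t \<otimes> \<delta> (n c) c = \<delta> (n c) c \<otimes> t"
        using wing_boundary(2)[OF nc t(1) t(1) self_in_panel[OF nc] _ _ True _ cd] \<open>n d \<noteq> n c\<close> by metis
      then have "inv (t \<otimes> inv w) = inv (inv w \<otimes> t)" by (simp add: winv)
      then show False using no_comm w t(1) by (simp add: inv_mult_group)
    qed
    have nd_out: "n d \<notin> wing t d"
    proof
      assume nd_in: "n d \<in> wing t d"
      have comm: "t \<otimes> \<delta> p (n c) = \<delta> p (n c) \<otimes> t"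
        using wing_boundary(2)[OF c t(1) t(1) p(1) d(1) _ p(2) nd_in nd(2)] d(3) by simp
      have "c \<in> pan t p" using panel_eq[OF c t(1) p(1)] self_in_panel[OF c] by simp
      then have "w = t \<otimes> \<delta> p (n c)"
        using \<delta>_other_in_panel[OF dCh(2) t(1) _ _ p(2)] p_ne by (simp add: w_def)
      then show False using no_comm comm t(1) \<delta>_closed[OF dCh(2) nc] by (simp flip: m_assoc)
    qed
    show ?thesis using *[OF dCh(1) nd_out d_out] dCh(1) t(1) by blast
  qed
qed

lemma edge_not_commute:
  assumes "(a, b) \<in> diagram_edges W S" shows "a \<in> S" "b \<in> S" "a \<noteq> b" "a \<otimes> b \<noteq> b \<otimes> a"
proof -
  show ab: "a \<in> S" "b \<in> S" "a \<noteq> b" using assms by (auto simp: diagram_edges_def)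
  have "ord (a \<otimes> b) \<noteq> 2" using assms by (auto simp: diagram_edges_def)
  then have ord: "ord (a \<otimes> b) = 0"
    using right_angled_type[unfolded right_angled_def, THEN bspec, THEN bspec, THEN mp, OF ab] by simp
  show "a \<otimes> b \<noteq> b \<otimes> a"
  proof
    assume "a \<otimes> b = b \<otimes> a"
    then have "(a \<otimes> b) [^] (2::nat) = a \<otimes> b \<otimes> (b \<otimes> a)" using ab by (simp add: numeral_2_eq_2)
    also have "\<dots> = \<one>" using ab by (simp add: m_assoc)
    finally show False using pow_eq_id[of "a \<otimes> b" 2] ord ab by simp
  qed
qed

text \<open>A chamber outside both wings would give an element with the two left descents \<open>a\<close> and \<open>b\<close>, which
  do not commute.\<close>

lemma edge_wings:
  assumes "(a, b) \<in> diagram_edges W S" "c \<in> Ch"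
  shows "Ch - wing b c \<subseteq> wing a c"
proof
  fix e assume e: "e \<in> Ch - wing b c"
  note ab = edge_not_commute[OF assms(1)]
  show "e \<in> wing a c"
  proof (rule ccontr)
    assume "e \<notin> wing a c"
    then have "len (a \<otimes> \<delta> c e) < len (\<delta> c e)" "len (b \<otimes> \<delta> c e) < len (\<delta> c e)"
      using not_in_wing[OF assms(2), of e a] not_in_wing[OF assms(2), of e b] e ab by auto
    then show False using left_descents(1)[OF ab(1-3) \<delta>_closed[OF assms(2)]] e ab(4) by auto
  qed
qed

text \<open>Along an edge of the diagram a wing contains the complement of a wing of the next type. This complement
  contains the wing of any other chamber of the same panel, from which one proceeds along the next edge.\<close>

lemma wing_contains_wing_complement:
  assumes "(t, s) \<in> (diagram_edges W S)\<^sup>+" "c \<in> Ch"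
  shows "\<exists>e\<in>Ch. Ch - wing s e \<subseteq> wing t c"
  using assms(1)
proof (induction rule: trancl_induct)
  case (base s)
  then show ?case using edge_wings assms(2) by blast
next
  case (step a b)
  then obtain e where e: "e \<in> Ch" "Ch - wing a e \<subseteq> wing t c" by blast
  have a: "a \<in> S" using edge_not_commute[OF step.hyps(2)] by simp
  obtain e' where e': "e' \<in> Ch" "\<delta> e' e = a" using \<delta>_step_ex[OF e(1) e(1) a] by blast
  have "e' \<in> pan a e" using adjacent_sym[OF e'(1) e(1) a e'(2)] e' by (simp add: panel_def)
  moreover have "e' \<noteq> e" using \<delta>_eq_one_iff[OF e'(1) e(1)] e'(2) S_neq_one[OF a] by simp
  ultimately have "wing a e' \<inter> wing a e = {}"
    using wing_disjoint[OF e(1) a _ self_in_panel[OF e(1)]] by simp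
  then have "wing a e' \<subseteq> wing t c" using e(2) wing_subset by blast
  then show ?case using edge_wings[OF step.hyps(2) e'(1)] e'(1) by blast
qed

end

section \<open>Automorphisms with prescribed action on the colors\<close>

context building
begin

lemma gate_unique:
  assumes x: "x \<in> Ch" "t \<in> S" and p: "p \<in> pan t x" "q \<in> pan t x" and c: "c \<in> Ch"
    and eq: "\<delta> p c = \<delta> q c" and up: "len (t \<otimes> \<delta> q c) = len (\<delta> q c) + 1"
  shows "p = q"
proof (rule ccontr)
  assume ne: "p \<noteq> q"
  have Ch: "p \<in> Ch" "q \<in> Ch" using p panel_subset by auto
  have "\<delta> p q = t" by (rule panel_adjacent[OF x p ne])
  then have "\<delta> p c = t \<otimes> \<delta> q c" using \<delta>_step_up[OF Ch(2) c Ch(1) x(2)] up by simp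
  then show False using eq up by simp
qed

lemma square_completion:
  assumes Ch: "x \<in> Ch" "y \<in> Ch" "z \<in> Ch" and ab: "a \<in> S" "b \<in> S" "a \<noteq> b" "a \<otimes> b = b \<otimes> a"
    and adj: "\<delta> x y = a" "\<delta> y z = b"
  shows "\<exists>y'\<in>Ch. \<delta> x y' = b \<and> \<delta> y' z = a"
proof -
  have "a \<otimes> b \<noteq> \<one>"
  proof
    assume one: "a \<otimes> b = \<one>"
    have "b = a \<otimes> (a \<otimes> b)" using ab(1,2) by simp
    also have "\<dots> = a" unfolding one using ab(1) by simp
    finally show False using ab(3) by simp
  qed
  then have "len (a \<otimes> b) \<noteq> 0" using len_eq_0[of "a \<otimes> b"] ab by auto
  then have "len (a \<otimes> b) = len b + 1" using len_mult_left[of a b] ab by auto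
  then have "\<delta> x z = a \<otimes> b" using \<delta>_step_up[OF Ch(2,3,1) ab(1) adj(1)] adj(2) by simp
  moreover obtain y' where y': "y' \<in> Ch" "\<delta> y' x = b" "\<delta> y' z = b \<otimes> \<delta> x z"
    using \<delta>_step_ex[OF Ch(1,3) ab(2)] by blast
  ultimately have "\<delta> y' z = a" using ab by simp
  then show ?thesis using y' adjacent_sym[OF y'(1) Ch(1) ab(2) y'(2)] by blast
qed

end

locale colored_building = right_angled_building +
  fixes Y :: "'a \<Rightarrow> 'y set" and h :: "'a \<Rightarrow> 'c \<Rightarrow> 'y"
  assumes legal: "t \<in> S \<Longrightarrow> legal_coloring S Ch \<delta> t (Y t) (h t)"
begin

lemma color_bij: "t \<in> S \<Longrightarrow> c \<in> Ch \<Longrightarrow> bij_betw (h t) (pan t c) (Y t)"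
  using legal[of t] by (auto simp: legal_coloring_def)

lemma color_in: "t \<in> S \<Longrightarrow> c \<in> Ch \<Longrightarrow> h t c \<in> Y t"
  using legal[of t] by (auto simp: legal_coloring_def)

lemma color_inj:
  assumes "t \<in> S" "c \<in> Ch" "x \<in> pan t c" "y \<in> pan t c" "h t x = h t y"
  shows "x = y"
  using bij_betw_imp_inj_on[OF color_bij[OF assms(1,2)]] assms by (auto dest: inj_onD)

lemma color_surj:
  assumes "t \<in> S" "c \<in> Ch" "y \<in> Y t"
  shows "\<exists>x\<in>pan t c. h t x = y"
  using bij_betw_imp_surj_on[OF color_bij[OF assms(1,2)]] assms by (metis imageE)

lemma color_adjacent:
  assumes "t \<in> S" "x \<in> Ch" "y \<in> Ch" "\<delta> x y \<in> S" "\<delta> x y \<noteq> t"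
  shows "h t y = h t x"
proof -
  have "y \<in> pan (\<delta> x y) x" using assms by (simp add: panel_def)
  then have "y \<in> res (S - {t}) x" using panel_in_residue[of x "\<delta> x y" "S - {t}"] assms by auto
  then show ?thesis using legal[OF assms(1)] assms(2) by (auto simp: legal_coloring_def)
qed

lemma color_adjacent_neq:
  assumes "t \<in> S" "x \<in> Ch" "y \<in> Ch" "\<delta> x y = t"
  shows "h t y \<noteq> h t x"
proof
  assume "h t y = h t x"
  moreover have "y \<in> pan t x" using assms by (simp add: panel_def)
  ultimately have "x = y" using color_inj[OF assms(1,2)] self_in_panel[OF assms(2)] by metis
  then show False using \<delta>_eq_one_iff[OF assms(2,3)] S_neq_one[OF assms(1)] assms(4) by simp
qed

end

text \<open>The aim is the automorphism that maps \<open>c\<close> to \<open>d\<close> and acts on the \<open>t\<close>-colors of all chambers by the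
  one permutation \<open>g t\<close>.\<close>

locale recoloring = colored_building W S Ch \<delta> Y h
  for W (structure) and S and Ch :: "'c set" and \<delta> and Y :: "'a \<Rightarrow> 'y set" and h :: "'a \<Rightarrow> 'c \<Rightarrow> 'y" +
  fixes g :: "'a \<Rightarrow> 'y \<Rightarrow> 'y" and c d :: 'c
  assumes g_bij: "t \<in> S \<Longrightarrow> bij_betw (g t) (Y t) (Y t)"
    and c: "c \<in> Ch" and d: "d \<in> Ch"
    and base_color: "t \<in> S \<Longrightarrow> h t d = g t (h t c)"
begin

text \<open>The image of a chamber is determined along every gallery from \<open>c\<close>, since a panel contains exactly one
  chamber of each color. Only galleries that move away from \<open>c\<close> in each step are followed; this makes
  induction on the distance from \<open>c\<close> possible when showing that the result does not depend on the
  gallery.\<close>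

inductive lift :: "'c \<Rightarrow> 'c \<Rightarrow> bool" where
  lift_base: "lift c d"
| lift_step: "\<lbrakk>lift x y; x' \<in> Ch; t \<in> S; \<delta> x' x = t; len (\<delta> x' c) = len (\<delta> x c) + 1;
    y' \<in> pan t y; h t y' = g t (h t x')\<rbrakk> \<Longrightarrow> lift x' y'"

lemma lift_properties:
  assumes "lift x y"
  shows "x \<in> Ch \<and> y \<in> Ch \<and> \<delta> y d = \<delta> x c \<and> (\<forall>t\<in>S. h t y = g t (h t x))"
  using assms
proof induction
  case lift_base
  then show ?case using c d base_color \<delta>_eq_one_iff[OF c c] \<delta>_eq_one_iff[OF d d] by simp
next
  case (lift_step x y x' t y')
  then have x: "x \<in> Ch" and y: "y \<in> Ch" and yx: "\<delta> y d = \<delta> x c"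
    and col: "\<And>t. t \<in> S \<Longrightarrow> h t y = g t (h t x)" by auto
  note x' = \<open>x' \<in> Ch\<close> and t = \<open>t \<in> S\<close> and adj = \<open>\<delta> x' x = t\<close>
  have y': "y' \<in> Ch" using lift_step.hyps panel_subset by auto
  have x'c: "\<delta> x' c = t \<otimes> \<delta> x c"
    using \<delta>_step[OF x c x' t adj] \<open>len (\<delta> x' c) = len (\<delta> x c) + 1\<close> by auto
  have xx': "\<delta> x x' = t" using adjacent_sym[OF x' x t adj] .
  have "h t x' \<noteq> h t x" by (rule color_adjacent_neq[OF t x x' xx'])
  then have "h t y' \<noteq> h t y"
    using lift_step.hyps(7) col[OF t] inj_onD[OF bij_betw_imp_inj_on[OF g_bij[OF t]]]
      color_in[OF t x] color_in[OF t x'] by metis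
  then have "y' \<noteq> y" by auto
  then have yy': "\<delta> y y' = t" using \<open>y' \<in> pan t y\<close> by (auto simp: panel_def)
  then have "\<delta> y' y = t" using adjacent_sym[OF y y' t] by simp
  then have "\<delta> y' d = t \<otimes> \<delta> y d"
    using \<delta>_step_up[OF y d y' t] yx x'c \<open>len (\<delta> x' c) = len (\<delta> x c) + 1\<close> by simp
  moreover have "h r y' = g r (h r x')" if r: "r \<in> S" for r
  proof (cases "r = t")
    case False
    then have "h r x' = h r x" "h r y' = h r y"
      using color_adjacent[OF r x x'] color_adjacent[OF r y y'] xx' yy' t by auto
    then show ?thesis using col[OF r] by simp
  qed (use lift_step.hyps(7) in simp)
  ultimately show ?case using x' y' yx x'c by simp
qed

lemma lift_exists:
  assumes "x \<in> Ch" shows "\<exists>y. lift x y"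
  using assms
proof (induction "len (\<delta> x c)" arbitrary: x)
  case 0
  then have "\<delta> x c = \<one>" using len_eq_0[OF \<delta>_closed[OF _ c]] by simp
  then have "x = c" using \<delta>_eq_one_iff[OF _ c] 0 by simp
  then show ?case using lift_base by blast
next
  case (Suc k)
  have w: "\<delta> x c \<in> carrier W" using \<delta>_closed[OF Suc.prems c] .
  have "\<delta> x c \<noteq> \<one>" using Suc.hyps(2) by auto
  then obtain t where t: "t \<in> S" "len (\<delta> x c) = len (t \<otimes> \<delta> x c) + 1"
    using left_descent_exists[OF w] by blast
  obtain z where z: "z \<in> Ch" "\<delta> z x = t" "\<delta> z c = t \<otimes> \<delta> x c"
    using \<delta>_step_ex[OF Suc.prems c t(1)] by blast
  then have "k = len (\<delta> z c)" using Suc.hyps(2) t(2) by simp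
  then obtain y where y: "lift z y" using Suc.hyps(1)[OF _ z(1)] by blast
  then have yCh: "y \<in> Ch" using lift_properties by blast
  have "g t (h t x) \<in> Y t"
    using bij_betwE[OF g_bij[OF t(1)]] color_in[OF t(1) Suc.prems] by blast
  then obtain y' where "y' \<in> pan t y" "h t y' = g t (h t x)" using color_surj[OF t(1) yCh] by blast
  moreover have "\<delta> x z = t" using adjacent_sym[OF z(1) Suc.prems t(1) z(2)] .
  ultimately show ?case using lift_step[OF y Suc.prems t(1)] t z(3) by auto
qed

text \<open>Two geodesic galleries from \<open>c\<close> to \<open>x\<close> may differ in their last steps. If these are of the same type, the
  penultimate chamber is the projection of \<open>c\<close> to that panel. If they are of types \<open>t1 \<noteq> t2\<close>, then
  \<open>t1\<close> and \<open>t2\<close> are descents of \<open>\<delta> x c\<close> and commute, so \<open>x\<close> and its two predecessors lie in a square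
  with a fourth chamber \<open>x0\<close> closer to \<open>c\<close>. The lifts of \<open>x\<close> obtained along the two sides of the square
  have the same colors and complete the lift of the other three chambers to a square, so they agree.\<close>

lemma lift_unique:
  assumes "lift x y1" "lift x y2" shows "y1 = y2"
  using assms
proof (induction "len (\<delta> x c)" arbitrary: x y1 y2 rule: less_induct)
  case less
  have xCh: "x \<in> Ch" using lift_properties less.prems by blast
  show ?case
  proof (cases "x = c")
    case True
    have "y = d" if "lift x y" for y
      using that
    proof cases
      case (lift_step x0 y0 t)
      then show ?thesis using True \<delta>_eq_one_iff[OF c c] by simp
    qed simp
    from this[OF less.prems(1)] this[OF less.prems(2)] show ?thesis by simp
  next
    case False
    define w where "w = \<delta> x c"
    have w: "w \<in> carrier W" using \<delta>_closed[OF xCh c] by (simp add: w_def)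
    obtain x1 z1 t1 where 1: "lift x1 z1" "t1 \<in> S" "\<delta> x x1 = t1" "len w = len (\<delta> x1 c) + 1"
      "y1 \<in> pan t1 z1" using less.prems(1) False by cases (auto simp: w_def)
    obtain x2 z2 t2 where 2: "lift x2 z2" "t2 \<in> S" "\<delta> x x2 = t2" "len w = len (\<delta> x2 c) + 1"
      "y2 \<in> pan t2 z2" using less.prems(2) False by cases (auto simp: w_def)
    note p1 = lift_properties[OF 1(1)] and p2 = lift_properties[OF 2(1)]
      and py1 = lift_properties[OF less.prems(1)] and py2 = lift_properties[OF less.prems(2)]
    have Ch: "x1 \<in> Ch" "x2 \<in> Ch" "z1 \<in> Ch" "z2 \<in> Ch" "y1 \<in> Ch" "y2 \<in> Ch"
      using p1 p2 py1 py2 by auto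
    have col: "h t y1 = h t y2" if "t \<in> S" for t using py1 py2 that by simp
    have down: "\<delta> x' c = t \<otimes> w"
      if "x' \<in> Ch" "t \<in> S" "\<delta> x x' = t" "len w = len (\<delta> x' c) + 1" for x' t
    proof -
      have "w = t \<otimes> \<delta> x' c" using \<delta>_step[OF that(1) c xCh that(2,3)] that(4) by (auto simp: w_def)
      then show ?thesis using that \<delta>_closed[OF that(1) c] by simp
    qed
    have x1c: "\<delta> x1 c = t1 \<otimes> w" and x2c: "\<delta> x2 c = t2 \<otimes> w"
      using down[OF Ch(1) 1(2,3,4)] down[OF Ch(2) 2(2,3,4)] by auto
    have pan_x: "x1 \<in> pan t1 x" "x2 \<in> pan t2 x" using Ch 1 2 by (auto simp: panel_def)
    show ?thesis
    proof (cases "t1 = t2")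
      case True
      have "x1 = x2"
        using gate_unique[OF xCh 1(2) pan_x(1) _ c] pan_x(2) x1c x2c True 1(2,4) w by simp
      then have "z1 = z2" using less.hyps[OF _ 1(1)] 2(1) 1(4) by (simp add: w_def)
      then show ?thesis using color_inj[OF 1(2) Ch(3) 1(5)] 2(5) True col[OF 1(2)] by simp
    next
      case ne: False
      have desc: "len (t1 \<otimes> w) < len w" "len (t2 \<otimes> w) < len w" using x1c x2c 1(4) 2(4) by auto
      have comm: "t1 \<otimes> t2 = t2 \<otimes> t1" and len2: "len (t2 \<otimes> (t1 \<otimes> w)) + 2 = len w"
        using left_descents[OF 1(2) 2(2) ne w desc] by auto
      obtain x0 where x0: "x0 \<in> Ch" "\<delta> x0 x1 = t2" "\<delta> x0 c = t2 \<otimes> (t1 \<otimes> w)"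
        using \<delta>_step_ex[OF Ch(1) c 2(2)] x1c by metis
      have x1x: "\<delta> x1 x = t1" by (rule adjacent_sym[OF xCh Ch(1) 1(2,3)])
      have x2x: "\<delta> x2 x = t2" by (rule adjacent_sym[OF xCh Ch(2) 2(2,3)])
      obtain x2' where x2': "x2' \<in> Ch" "\<delta> x0 x2' = t1" "\<delta> x2' x = t2"
        using square_completion[OF x0(1) Ch(1) xCh 2(2) 1(2) _ _ x0(2) x1x] ne comm by metis
      have x2'x0: "\<delta> x2' x0 = t1" by (rule adjacent_sym[OF x0(1) x2'(1) 1(2) x2'(2)])
      have xx2': "\<delta> x x2' = t2" by (rule adjacent_sym[OF x2'(1) xCh 2(2) x2'(3)])
      have "len (\<delta> x2' c) \<le> len w - 1"
        using \<delta>_step[OF x0(1) c x2'(1) 1(2) x2'x0] x0(3) len2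
          len_mult_left[OF 1(2), of "t2 \<otimes> (t1 \<otimes> w)"] 1(2) 2(2) w by auto
      moreover have "w = t2 \<otimes> \<delta> x2' c \<or> w = \<delta> x2' c"
        using \<delta>_step[OF x2'(1) c xCh 2(2) xx2'] by (simp add: w_def)
      ultimately have x2'c: "\<delta> x2' c = t2 \<otimes> w"
        using len2 2(2) \<delta>_closed[OF x2'(1) c] by auto
      have "x2' \<in> pan t2 x" using x2'(1) xx2' by (simp add: panel_def)
      then have "x2' = x2" using gate_unique[OF xCh 2(2) _ pan_x(2) c] x2'c x2c 2(2,4) w by simp
      then have x2x0: "\<delta> x2 x0 = t1" using x2'x0 by simp
      have x1x0: "\<delta> x1 x0 = t2" by (rule adjacent_sym[OF x0(1) Ch(1) 2(2) x0(2)])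
      obtain y0 where y0: "lift x0 y0" using lift_exists[OF x0(1)] by blast
      note p0 = lift_properties[OF y0]
      then have y0Ch: "y0 \<in> Ch" by simp
      have in_pan: "z \<in> pan t y0" if zz: "lift x' z" "t \<in> S" "\<delta> x' x0 = t" "len w = len (\<delta> x' c) + 1" for x' z t
      proof -
        have x': "x' \<in> Ch" using lift_properties[OF zz(1)] by simp
        have "g t (h t x') \<in> Y t"
          using bij_betwE[OF g_bij[OF zz(2)]] color_in[OF zz(2) x'] by blast
        then obtain z' where z': "z' \<in> pan t y0" "h t z' = g t (h t x')"
          using color_surj[OF zz(2) y0Ch] by blast
        have "lift x' z'"
          by (rule lift_step[OF y0 x' zz(2,3) _ z']) (use len2 x0(3) zz(4) in simp)
        then have "z' = z" using less.hyps[OF _ _ zz(1)] zz(4) by (simp add: w_def)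
        then show ?thesis using z' by simp
      qed
      have z1: "z1 \<in> pan t2 y0" by (rule in_pan[OF 1(1) 2(2) x1x0 1(4)])
      have z2: "z2 \<in> pan t1 y0" by (rule in_pan[OF 2(1) 1(2) x2x0 2(4)])
      have "z1 \<noteq> y0" using p0 p1 x0(3) len2 1(4) by auto
      then have y0z1: "\<delta> y0 z1 = t2" using z1 by (simp add: panel_def)
      have "y1 \<noteq> z1" using p1 py1 1(4) by (auto simp: w_def)
      then have z1y1: "\<delta> z1 y1 = t1" using 1(5) by (simp add: panel_def)
      obtain z where z: "z \<in> Ch" "\<delta> y0 z = t1" "\<delta> z y1 = t2"
        using square_completion[OF y0Ch Ch(3,5) 2(2) 1(2) _ _ y0z1 z1y1] ne comm by metis
      have "h t1 z = h t1 y1" using color_adjacent[OF 1(2) z(1) Ch(5)] z(3) ne 2(2) by simp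
      also have "\<dots> = g t1 (h t1 x)" using py1 1(2) by simp
      also have "\<dots> = g t1 (h t1 x2)" using color_adjacent[OF 1(2) Ch(2) xCh] x2x ne 2(2) by simp
      also have "\<dots> = h t1 z2" using p2 1(2) by simp
      finally have "z = z2" using color_inj[OF 1(2) y0Ch _ z2] z by (simp add: panel_def)
      then have "y1 \<in> pan t2 z2" using z(3) Ch(5) by (simp add: panel_def)
      then show ?thesis using color_inj[OF 2(2) Ch(4) _ 2(5)] col[OF 2(2)] by simp
    qed
  qed
qed

definition lift_fun :: "'c \<Rightarrow> 'c" where
  "lift_fun = (\<lambda>x\<in>Ch. THE y. lift x y)"

lemma lift_fun: "x \<in> Ch \<Longrightarrow> lift x (lift_fun x)"
  using lift_exists[of x] lift_unique[of x] theI'[of "lift x"] unfolding lift_fun_def by auto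

lemma lift_fun_eq: "lift x y \<Longrightarrow> lift_fun x = y"
  using lift_unique lift_fun lift_properties by blast

lemma lift_fun_closed: "x \<in> Ch \<Longrightarrow> lift_fun x \<in> Ch"
  using lift_fun lift_properties by blast

lemma lift_fun_color: "x \<in> Ch \<Longrightarrow> t \<in> S \<Longrightarrow> h t (lift_fun x) = g t (h t x)"
  using lift_fun lift_properties by blast

text \<open>All chambers of a panel are lifted from the projection of \<open>c\<close> to that panel.\<close>

lemma lift_fun_panel:
  assumes x: "x \<in> Ch" and t: "t \<in> S" and x': "x' \<in> pan t x"
  shows "lift_fun x' \<in> pan t (lift_fun x)"
proof -
  obtain p where p: "p \<in> pan t x" "c \<in> wing t p" using wing_cover[OF x t c] .
  have pCh: "p \<in> Ch" using p panel_subset by auto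
  have *: "lift_fun q \<in> pan t (lift_fun p)" if q: "q \<in> pan t x" for q
  proof (cases "q = p")
    case True
    then show ?thesis using self_in_panel lift_fun_closed pCh by simp
  next
    case False
    have qCh: "q \<in> Ch" using q panel_subset by auto
    have qp: "\<delta> q p = t" by (rule panel_adjacent[OF x t q p(1) False])
    have "q \<in> pan t p" using panel_eq[OF x t p(1)] q by simp
    then have "\<delta> q c = t \<otimes> \<delta> p c" using \<delta>_other_in_panel[OF pCh t _ False p(2)] by simp
    then have up: "len (\<delta> q c) = len (\<delta> p c) + 1" using p(2) by (simp add: wing_def)
    have "g t (h t q) \<in> Y t" using bij_betwE[OF g_bij[OF t]] color_in[OF t qCh] by blast
    then obtain y where y: "y \<in> pan t (lift_fun p)" "h t y = g t (h t q)"
      using color_surj[OF t lift_fun_closed[OF pCh]] by blast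
    have "lift q y" by (rule lift_step[OF lift_fun[OF pCh] qCh t qp up y])
    then show ?thesis using lift_fun_eq y by simp
  qed
  have "pan t (lift_fun x) = pan t (lift_fun p)"
    by (rule panel_eq[OF lift_fun_closed[OF pCh] t *[OF self_in_panel[OF x]]])
  then show ?thesis using *[OF x'] by simp
qed

lemma lift_fun_isometry:
  assumes "x \<in> Ch" "y \<in> Ch" shows "\<delta> (lift_fun x) (lift_fun y) = \<delta> x y"
proof (rule adjacency_preserving_imp_isometry[OF _ _ assms])
  show "lift_fun \<in> Ch \<rightarrow> Ch" using lift_fun_closed by blast
  fix x y assume xy: "x \<in> Ch" "y \<in> Ch" and t: "\<delta> x y \<in> S"
  have "y \<in> pan (\<delta> x y) x" using xy by (simp add: panel_def)
  then have "lift_fun y \<in> pan (\<delta> x y) (lift_fun x)" by (rule lift_fun_panel[OF xy(1) t])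
  moreover have "lift_fun y \<noteq> lift_fun x"
  proof
    assume "lift_fun y = lift_fun x"
    then have "g (\<delta> x y) (h (\<delta> x y) y) = g (\<delta> x y) (h (\<delta> x y) x)"
      using lift_fun_color[OF xy(1) t] lift_fun_color[OF xy(2) t] by simp
    then have "h (\<delta> x y) y = h (\<delta> x y) x"
      using inj_onD[OF bij_betw_imp_inj_on[OF g_bij[OF t]]] color_in[OF t xy(1)] color_in[OF t xy(2)]
      by blast
    then show False using color_adjacent_neq[OF t xy] by simp
  qed
  ultimately show "\<delta> (lift_fun x) (lift_fun y) = \<delta> x y" by (simp add: panel_def)
qed

lemma lift_fun_surj:
  assumes "z \<in> Ch" shows "z \<in> lift_fun ` Ch"
  using assms
proof (induction "len (\<delta> z d)" arbitrary: z)
  case 0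
  then have "\<delta> z d = \<one>" using len_eq_0[OF \<delta>_closed[OF _ d]] by simp
  then have "z = d" using \<delta>_eq_one_iff[OF _ d] 0 by simp
  then show ?case using lift_fun_eq[OF lift_base] c by (metis imageI)
next
  case (Suc k)
  have w: "\<delta> z d \<in> carrier W" using \<delta>_closed[OF Suc.prems d] .
  have "\<delta> z d \<noteq> \<one>" using Suc.hyps(2) by auto
  then obtain t where t: "t \<in> S" "len (\<delta> z d) = len (t \<otimes> \<delta> z d) + 1"
    using left_descent_exists[OF w] by blast
  obtain z1 where z1: "z1 \<in> Ch" "\<delta> z1 z = t" "\<delta> z1 d = t \<otimes> \<delta> z d"
    using \<delta>_step_ex[OF Suc.prems d t(1)] by blast
  then have "k = len (\<delta> z1 d)" using Suc.hyps(2) t(2) by simp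
  then obtain x1 where x1: "x1 \<in> Ch" "z1 = lift_fun x1" using Suc.hyps(1)[OF _ z1(1)] by blast
  obtain a where a: "a \<in> Y t" "g t a = h t z"
    using bij_betw_imp_surj_on[OF g_bij[OF t(1)]] color_in[OF t(1) Suc.prems] by (metis imageE)
  obtain x where x: "x \<in> pan t x1" "h t x = a" using color_surj[OF t(1) x1(1) a(1)] by blast
  have xCh: "x \<in> Ch" using x panel_subset by auto
  have "lift_fun x \<in> pan t z1" using lift_fun_panel[OF x1(1) t(1) x(1)] x1(2) by simp
  moreover have "z \<in> pan t z1" using z1 Suc.prems by (simp add: panel_def)
  moreover have "h t (lift_fun x) = h t z" using lift_fun_color[OF xCh t(1)] x a by simp
  ultimately have "lift_fun x = z" using color_inj[OF t(1) z1(1)] by blast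
  then show ?case using xCh by blast
qed

lemma lift_fun_Aut: "lift_fun \<in> Aut Ch \<delta>"
proof -
  have "inj_on lift_fun Ch"
  proof (rule inj_onI)
    fix x y assume xy: "x \<in> Ch" "y \<in> Ch" "lift_fun x = lift_fun y"
    have "\<delta> (lift_fun x) (lift_fun y) = \<one>"
      using \<delta>_eq_one_iff lift_fun_closed xy by simp
    then have "\<delta> x y = \<one>" using lift_fun_isometry[OF xy(1,2)] by simp
    then show "x = y" using \<delta>_eq_one_iff[OF xy(1,2)] by simp
  qed
  moreover have "lift_fun ` Ch = Ch" using lift_fun_surj lift_fun_closed by blast
  moreover have "lift_fun \<in> extensional Ch" by (simp add: lift_fun_def)
  ultimately show ?thesis using lift_fun_isometry by (simp add: Aut_def Bij_def bij_betw_def)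
qed

end

context colored_building
begin

lemma recoloring_automorphism:
  assumes "\<And>t. t \<in> S \<Longrightarrow> bij_betw (g t) (Y t) (Y t)" "c \<in> Ch" "d \<in> Ch"
    and "\<And>t. t \<in> S \<Longrightarrow> h t d = g t (h t c)"
  shows "\<exists>f\<in>Aut Ch \<delta>. f c = d \<and> (\<forall>t\<in>S. \<forall>x\<in>Ch. h t (f x) = g t (h t x))"
proof -
  interpret recoloring W S Ch \<delta> Y h g c d
    by unfold_locales (use assms in auto)
  show ?thesis using lift_fun_Aut lift_fun_eq[OF lift_base] lift_fun_color by blast
qed

end

section \<open>The universal group\<close>

locale universal_group_building = colored_building +
  fixes G :: "'a \<Rightarrow> ('d \<Rightarrow> 'd) set" and U :: "('c \<Rightarrow> 'c) set"
  assumes G: "t \<in> S \<Longrightarrow> transitive_perm_group (Y t) (G t)"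
    and U: "U = universal_group S Ch \<delta> Y h G"
begin

lemma G_Bij: "t \<in> S \<Longrightarrow> G t \<subseteq> Bij (Y t)"
  using G[of t] subgroup.subset by (fastforce simp: transitive_perm_group_def BijGroup_def)

lemma G_transitive:
  assumes "t \<in> S" "y \<in> Y t" "y' \<in> Y t" shows "\<exists>g\<in>G t. g y = y'"
proof -
  interpret transitive_action "BijGroup (Y t)\<lparr>carrier := G t\<rparr>" "Y t" "\<lambda>g. g"
    using G[OF assms(1)] by (simp add: transitive_perm_group_def)
  show ?thesis using unique_orbit[OF assms(2,3)] by simp
qed

lemma U_Aut: "U \<subseteq> Aut Ch \<delta>"
  by (auto simp: U universal_group_def)

lemma U_Bij: "U \<subseteq> Bij Ch"
  using U_Aut by (auto simp: Aut_def)

lemma U_isometry: "g \<in> U \<Longrightarrow> x \<in> Ch \<Longrightarrow> y \<in> Ch \<Longrightarrow> \<delta> (g x) (g y) = \<delta> x y"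
  using U_Aut by (auto simp: Aut_def)

lemma U_closed: "g \<in> U \<Longrightarrow> x \<in> Ch \<Longrightarrow> g x \<in> Ch"
  using U_Bij Bij_imp_funcset by blast

lemma U_panel: "g \<in> U \<Longrightarrow> c \<in> Ch \<Longrightarrow> x \<in> pan t c \<Longrightarrow> g x \<in> pan t (g c)"
  using U_isometry[of g c x] U_closed[of g x] by (auto simp: panel_def)

lemma U_wing: "g \<in> U \<Longrightarrow> c \<in> Ch \<Longrightarrow> x \<in> Ch \<Longrightarrow> g x \<in> wing t (g c) \<longleftrightarrow> x \<in> wing t c"
  using U_isometry[of g c x] U_closed[of g x] by (auto simp: wing_def)

text \<open>Preservation of \<open>\<delta>\<close> follows from preservation of adjacency, and both this and the local actions involve
  only one panel at a time.\<close>

lemma panelwise_in_U: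
  assumes f: "f \<in> Bij Ch" and loc: "\<And>t c. t \<in> S \<Longrightarrow> c \<in> Ch \<Longrightarrow> \<exists>g\<in>U. \<forall>x\<in>pan t c. f x = g x"
  shows "f \<in> U"
proof -
  have "\<delta> (f x) (f y) = \<delta> x y" if "x \<in> Ch" "y \<in> Ch" for x y
  proof (rule adjacency_preserving_imp_isometry[OF Bij_imp_funcset[OF f] _ that])
    fix x y assume xy: "x \<in> Ch" "y \<in> Ch" "\<delta> x y \<in> S"
    obtain g where g: "g \<in> U" "\<forall>z\<in>pan (\<delta> x y) x. f z = g z" using loc[OF xy(3,1)] by blast
    then have "f x = g x" "f y = g y" using xy by (auto simp: panel_def)
    then show "\<delta> (f x) (f y) = \<delta> x y" using U_isometry[OF g(1) xy(1,2)] by simp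
  qed
  then have Aut: "f \<in> Aut Ch \<delta>" using f by (simp add: Aut_def)
  have "local_action Ch \<delta> t (Y t) (h t) f c \<in> G t" if tc: "t \<in> S" "c \<in> Ch" for t c
  proof -
    obtain g where g: "g \<in> U" "\<forall>x\<in>pan t c. f x = g x" using loc[OF tc] by blast
    have "inv_into (pan t c) (h t) y \<in> pan t c" if "y \<in> Y t" for y
      using that bij_betw_imp_surj_on[OF color_bij[OF tc]] inv_into_into by metis
    then have "local_action Ch \<delta> t (Y t) (h t) f c = local_action Ch \<delta> t (Y t) (h t) g c"
      unfolding local_action_def using g(2) by (intro restrict_ext) simp
    then show ?thesis using g(1) tc by (simp add: U universal_group_def)
  qed
  then show ?thesis using Aut by (simp add: U universal_group_def)
qed

text \<open>The recoloring by permutations \<open>g t \<in> G t\<close> that take the colors of \<open>c\<close> to those of \<open>d\<close> has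
  \<open>g t\<close> as its local action at every \<open>t\<close>-panel.\<close>

lemma U_chamber_transitive:
  assumes "c \<in> Ch" "d \<in> Ch" shows "\<exists>u\<in>U. u c = d"
proof -
  have "\<forall>t\<in>S. \<exists>k. k \<in> G t \<and> k (h t c) = h t d"
  proof
    fix t assume t: "t \<in> S"
    from G_transitive[OF t color_in[OF t assms(1)] color_in[OF t assms(2)]]
    show "\<exists>k. k \<in> G t \<and> k (h t c) = h t d" unfolding Bex_def .
  qed
  from bchoice[OF this] obtain g where choice: "\<forall>t\<in>S. g t \<in> G t \<and> g t (h t c) = h t d" ..
  have g: "g t \<in> G t" "h t d = g t (h t c)" if "t \<in> S" for t
    using bspec[OF choice that] by simp_all
  have gBij: "g t \<in> Bij (Y t)" if "t \<in> S" for t using g(1)[OF that] G_Bij[OF that] by blast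
  have "bij_betw (g t) (Y t) (Y t)" if "t \<in> S" for t using gBij[OF that] by (simp add: Bij_def)
  from recoloring_automorphism[of g, OF this assms g(2)] obtain f
    where f: "f \<in> Aut Ch \<delta>" "f c = d" "\<forall>t\<in>S. \<forall>x\<in>Ch. h t (f x) = g t (h t x)" by blast
  have "local_action Ch \<delta> t (Y t) (h t) f x = g t" if tx: "t \<in> S" "x \<in> Ch" for t x
  proof
    fix y
    show "local_action Ch \<delta> t (Y t) (h t) f x y = g t y"
    proof (cases "y \<in> Y t")
      case True
      let ?z = "inv_into (pan t x) (h t) y"
      have surj: "y \<in> h t ` pan t x" using True bij_betw_imp_surj_on[OF color_bij[OF tx]] by simp
      have "?z \<in> Ch" using inv_into_into[OF surj] panel_subset by blast
      then have "h t (f ?z) = g t (h t ?z)" using f(3) tx(1) by simp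
      also have "h t ?z = y" by (rule f_inv_into_f[OF surj])
      finally have "h t (f ?z) = g t y" .
      then show ?thesis using True by (simp add: local_action_def)
    next
      case False
      then show ?thesis using extensional_arb[OF Bij_imp_extensional[OF gBij[OF tx(1)]]]
        by (simp add: local_action_def)
    qed
  qed
  then have "local_action Ch \<delta> t (Y t) (h t) f x \<in> G t" if "t \<in> S" "x \<in> Ch" for t x
    using g(1)[OF that(1)] that by simp
  then have "f \<in> U" using f(1) by (simp add: U universal_group_def)
  then show ?thesis using f(2) by blast
qed

text \<open>A panel either lies in one of the sets \<open>A i\<close>, where the glued map agrees with \<open>f i\<close>, or the glued map is
  the identity on it.\<close>

lemma glue:
  fixes A :: "'i \<Rightarrow> 'c set"
  assumes one: "(\<lambda>x\<in>Ch. x) \<in> U"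
    and f: "\<And>i. f i \<in> U" and A: "\<And>i. A i \<subseteq> Ch" and inv: "\<And>i. f i ` A i = A i"
    and disj: "\<And>i j. i \<noteq> j \<Longrightarrow> A i \<inter> A j = {}"
    and bdry: "\<And>i t c. t \<in> S \<Longrightarrow> c \<in> Ch \<Longrightarrow> pan t c \<subseteq> A i \<or> (\<forall>x\<in>pan t c \<inter> A i. f i x = x)"
  shows "\<exists>u\<in>U. (\<forall>i. \<forall>x\<in>A i. u x = f i x) \<and> (\<forall>x\<in>Ch - (\<Union>i. A i). u x = x)"
proof -
  define u where "u = (\<lambda>x\<in>Ch. if x \<in> (\<Union>i. A i) then f (THE i. x \<in> A i) x else x)"
  have uA: "u x = f i x" if "x \<in> A i" for x i
  proof -
    have "(THE i. x \<in> A i) = i" using disj that by (intro the_equality) blast+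
    then show ?thesis using that A by (auto simp: u_def)
  qed
  have u_out: "u x = x" if "x \<in> Ch - (\<Union>i. A i)" for x using that by (simp add: u_def)
  have uAi: "u ` A i = A i" for i using inv[of i] uA by (metis image_cong)
  have "u \<in> Bij Ch"
  proof -
    have "inj_on u Ch"
    proof (rule inj_onI)
      fix x y assume xy: "x \<in> Ch" "y \<in> Ch" "u x = u y"
      have same: "x \<in> A i \<longleftrightarrow> u x \<in> A i" if "x \<in> Ch" for x i
      proof (cases "x \<in> (\<Union>i. A i)")
        case True
        then obtain j where j: "x \<in> A j" by blast
        then have "u x \<in> A j" using uAi by blast
        then show ?thesis using j disj by (metis disjoint_iff)
      qed (use u_out that in simp)
      show "x = y"
      proof (cases "x \<in> (\<Union>i. A i)")
        case True
        then obtain i where i: "x \<in> A i" by blast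
        then have "y \<in> A i" using same xy by metis
        then have "f i x = f i y" using uA i xy by simp
        moreover have "inj_on (f i) Ch" using f U_Bij by (auto simp: Bij_def bij_betw_def)
        ultimately show ?thesis using xy by (auto dest: inj_onD)
      next
        case False
        then have "y \<notin> (\<Union>i. A i)" using same xy by auto
        then show ?thesis using False u_out xy by simp
      qed
    qed
    moreover have "u ` Ch = Ch"
    proof
      show "u ` Ch \<subseteq> Ch" using U_closed f by (auto simp: u_def)
      show "Ch \<subseteq> u ` Ch"
      proof
        fix x assume x: "x \<in> Ch"
        show "x \<in> u ` Ch"
        proof (cases "x \<in> (\<Union>i. A i)")
          case True
          then show ?thesis using uAi A by blast
        next
          case False
          then show ?thesis using u_out[of x] x by (metis DiffI image_eqI)
        qed
      qed
    qed
    ultimately show ?thesis by (simp add: Bij_def bij_betw_def u_def)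
  qed
  moreover have "\<exists>g\<in>U. \<forall>x\<in>pan t c. u x = g x" if tc: "t \<in> S" "c \<in> Ch" for t c
  proof (cases "\<exists>i. pan t c \<subseteq> A i")
    case True
    then show ?thesis using uA f by blast
  next
    case False
    have "u x = (\<lambda>x\<in>Ch. x) x" if x: "x \<in> pan t c" for x
    proof (cases "x \<in> (\<Union>i. A i)")
      case True
      then show ?thesis using bdry[OF tc] False x uA A by fastforce
    next
      case False
      then show ?thesis using u_out x panel_subset by fastforce
    qed
    then show ?thesis using one by blast
  qed
  ultimately have "u \<in> U" by (rule panelwise_in_U)
  then show ?thesis using uA u_out by blast
qed

end

section \<open>Normal subgroups of the universal group\<close>

locale universal_normal_subgroup = universal_group_building +
  fixes N :: "('c \<Rightarrow> 'c) set"
  assumes normal: "N \<lhd> (BijGroup Ch\<lparr>carrier := U\<rparr>)"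
begin

sublocale UN: normal N "BijGroup Ch\<lparr>carrier := U\<rparr>"
  by (rule normal)

lemma N_in_U: "n \<in> N \<Longrightarrow> n \<in> U"
  using UN.subset by auto

lemma mult_is_compose: "f \<in> U \<Longrightarrow> g \<in> U \<Longrightarrow> f \<otimes>\<^bsub>BijGroup Ch\<lparr>carrier := U\<rparr>\<^esub> g = compose Ch f g"
  using U_Bij by (auto simp: BijGroup_def)

lemma one_is_identity: "\<one>\<^bsub>BijGroup Ch\<lparr>carrier := U\<rparr>\<^esub> = (\<lambda>x\<in>Ch. x)"
  by (simp add: BijGroup_def)

lemma one_in_U: "(\<lambda>x\<in>Ch. x) \<in> U"
  using UN.one_closed unfolding one_is_identity by simp

lemma one_in_N: "(\<lambda>x\<in>Ch. x) \<in> N"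
  using UN.subgroup_axioms subgroup.one_closed[of N "BijGroup Ch\<lparr>carrier := U\<rparr>"] unfolding one_is_identity by blast

lemma compose_U: "f \<in> U \<Longrightarrow> g \<in> U \<Longrightarrow> compose Ch f g \<in> U"
  using UN.m_closed[of f g] mult_is_compose by simp

lemma compose_N:
  assumes "f \<in> N" "g \<in> N" shows "compose Ch f g \<in> N"
  using subgroup.m_closed[OF UN.subgroup_axioms assms] mult_is_compose[OF N_in_U[OF assms(1)] N_in_U[OF assms(2)]]
  by simp

definition uinv :: "('c \<Rightarrow> 'c) \<Rightarrow> 'c \<Rightarrow> 'c" where
  "uinv f = inv\<^bsub>BijGroup Ch\<lparr>carrier := U\<rparr>\<^esub> f"

lemma uinv_U: "f \<in> U \<Longrightarrow> uinv f \<in> U"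
  using UN.inv_closed[of f] by (simp add: uinv_def)

lemma uinv_N: "f \<in> N \<Longrightarrow> uinv f \<in> N"
  using subgroup.m_inv_closed[OF UN.subgroup_axioms] by (simp add: uinv_def)

lemma uinv_left: "f \<in> U \<Longrightarrow> x \<in> Ch \<Longrightarrow> uinv f (f x) = x"
  using UN.l_inv[of f] mult_is_compose[OF uinv_U, of f f] unfolding one_is_identity uinv_def
  by (auto simp: compose_def dest: fun_cong[of _ _ x])

lemma uinv_right: "f \<in> U \<Longrightarrow> x \<in> Ch \<Longrightarrow> f (uinv f x) = x"
  using UN.r_inv[of f] mult_is_compose[OF _ uinv_U, of f f] unfolding one_is_identity uinv_def
  by (auto simp: compose_def dest: fun_cong[of _ _ x])

lemma conj_N:
  assumes "u \<in> U" "n \<in> N" shows "compose Ch (compose Ch u n) (uinv u) \<in> N"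
  using UN.inv_op_closed2[of u n] assms mult_is_compose[OF assms(1) N_in_U[OF assms(2)]]
    mult_is_compose[OF compose_U[OF assms(1) N_in_U[OF assms(2)]] uinv_U[OF assms(1)]]
  by (simp add: uinv_def)

text \<open>Put \<open>B k = n\<^sup>k A\<close> and \<open>f k = n\<^sup>k g n\<^sup>-\<^sup>k\<close>. The sets \<open>B k\<close> are pairwise disjoint, as those with
  \<open>k > 0\<close> lie in \<open>n H\<close>, so the maps \<open>f k\<close> on \<open>B k\<close> glue to an element \<open>u\<close> of \<open>U\<close>. Conjugation by
  \<open>n\<close> shifts the factors of \<open>u\<close>, and \<open>u (n u n\<^sup>-\<^sup>1)\<^sup>-\<^sup>1\<close> retains only the factor \<open>f 0 = g\<close>.\<close>

lemma contraction:
  assumes g: "g \<in> U" and n: "n \<in> N" and A: "A \<subseteq> H" and H: "H \<subseteq> Ch"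
    and nH: "n ` H \<subseteq> H" "n ` H \<inter> A = {}" and gA: "g ` A = A"
    and bdry: "\<And>t c. t \<in> S \<Longrightarrow> c \<in> Ch \<Longrightarrow> pan t c \<subseteq> A \<or> (\<forall>x\<in>pan t c \<inter> A. g x = x)"
  shows "(\<lambda>x\<in>Ch. if x \<in> A then g x else x) \<in> N"
proof -
  have nU: "n \<in> U" by (rule N_in_U[OF n])
  define n' where "n' = uinv n"
  have n'U: "n' \<in> U" unfolding n'_def by (rule uinv_U[OF nU])
  have n'n: "n' (n x) = x" and nn': "n (n' x) = x" if "x \<in> Ch" for x
    unfolding n'_def using uinv_left[OF nU that] uinv_right[OF nU that] .
  define B where "B k = ((`) n ^^ k) A" for k :: nat
  define f where "f k = ((\<lambda>f. compose Ch n (compose Ch f n')) ^^ k) g" for k :: nat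
  have B0: "B 0 = A" and BS: "B (Suc k) = n ` B k" for k by (simp_all add: B_def)
  have f0: "f 0 = g" and fS: "f (Suc k) = compose Ch n (compose Ch (f k) n')" for k by (simp_all add: f_def)
  have BH: "B k \<subseteq> H" for k
  proof (induction k)
    case (Suc k)
    then show ?case using nH(1) unfolding BS by blast
  qed (use A B0 in simp)
  then have BCh: "B k \<subseteq> Ch" for k using H by blast
  have fU: "f k \<in> U" for k
  proof (induction k)
    case (Suc k)
    then show ?case unfolding fS by (intro compose_U nU n'U)
  qed (use g f0 in simp)
  have f_n: "f (Suc k) (n x) = n (f k x)" if "x \<in> Ch" for k x
    using U_closed[OF nU that] n'n[OF that] unfolding fS by (simp add: compose_def)
  have fB: "f k ` B k = B k" for k
  proof (induction k)
    case (Suc k)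
    have "f (Suc k) ` (n ` B k) = n ` (f k ` B k)"
      unfolding image_image using f_n BCh[of k] by (intro image_cong) auto
    then show ?case using Suc by (simp add: BS)
  qed (use gA B0 f0 in simp)
  have n_inj: "inj_on n Ch" using U_Bij nU by (auto simp: Bij_def bij_betw_def)
  have disj_less: "B j \<inter> B (j + Suc k) = {}" for j k
  proof (induction j)
    case 0
    have "B (Suc k) \<subseteq> n ` H" unfolding BS using BH by blast
    then show ?case using nH(2) B0 by auto
  next
    case (Suc j)
    have "B (Suc j) \<inter> B (Suc j + Suc k) = n ` (B j \<inter> B (j + Suc k))"
      using inj_on_image_Int[OF n_inj BCh[of j] BCh[of "j + Suc k"]] by (simp add: BS)
    then show ?case unfolding Suc.IH by simp
  qed
  have disj: "B i \<inter> B j = {}" if "i \<noteq> j" for i j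
  proof (cases "i < j")
    case True
    then show ?thesis using disj_less[of i "j - Suc i"] by simp
  next
    case False
    then show ?thesis using disj_less[of j "i - Suc j"] that by (simp add: Int_commute)
  qed
  have bdry_f: "pan t c \<subseteq> B k \<or> (\<forall>x\<in>pan t c \<inter> B k. f k x = x)" if "t \<in> S" "c \<in> Ch" for k t c
    using that(2)
  proof (induction k arbitrary: c)
    case 0
    then show ?case using bdry[OF that(1)] B0 f0 by simp
  next
    case (Suc k)
    have pre: "n' x \<in> pan t (n' c) \<and> n (n' x) = x" if "x \<in> pan t c" for x
      using U_panel[OF n'U Suc.prems that] nn' that panel_subset by blast
    from Suc.IH[OF U_closed[OF n'U Suc.prems]] show ?case
    proof
      assume "pan t (n' c) \<subseteq> B k"
      then have "pan t c \<subseteq> B (Suc k)" unfolding BS using pre by (metis imageI subset_iff)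
      then show ?thesis ..
    next
      assume fix_k: "\<forall>x\<in>pan t (n' c) \<inter> B k. f k x = x"
      have "f (Suc k) x = x" if x: "x \<in> pan t c \<inter> B (Suc k)" for x
      proof -
        obtain y where y: "y \<in> B k" "x = n y" using x unfolding BS by blast
        have yCh: "y \<in> Ch" using y BCh by blast
        have "y \<in> pan t (n' c)" using pre[of x] x y n'n[OF yCh] by auto
        then have "f k y = y" using fix_k y by blast
        then show ?thesis using f_n[OF yCh] y by simp
      qed
      then show ?thesis by blast
    qed
  qed
  obtain u where u: "u \<in> U" "\<And>k x. x \<in> B k \<Longrightarrow> u x = f k x"
    and u_out: "\<And>x. x \<in> Ch - (\<Union>k. B k) \<Longrightarrow> u x = x"
    using glue[of f B, OF one_in_U fU BCh fB disj bdry_f] by blast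
  \<comment> \<open>The bracketing shows that the commutator is a product of a conjugate of \<open>n\<close> and of \<open>n\<^sup>-\<^sup>1\<close>.\<close>
  define v where "v = compose Ch (compose Ch (compose Ch u n) (uinv u)) n'"
  have vN: "v \<in> N" unfolding v_def n'_def by (intro compose_N conj_N uinv_N u(1) n)
  have v: "v (n (u y)) = u (n y)" if y: "y \<in> Ch" for y
    using y U_closed[OF nU U_closed[OF u(1) y]] n'n[OF U_closed[OF u(1) y]] uinv_left[OF u(1) y]
      U_closed[OF u(1) y] unfolding v_def by (simp add: compose_def)
  have "v x = (if x \<in> A then g x else x)" if x: "x \<in> Ch" for x
  proof -
    define y where "y = uinv u (n' x)"
    have y: "y \<in> Ch" unfolding y_def by (intro U_closed[OF uinv_U[OF u(1)]] U_closed[OF n'U] x)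
    have "u y = n' x" unfolding y_def by (rule uinv_right[OF u(1) U_closed[OF n'U x]])
    then have xy: "x = n (u y)" using nn'[OF x] by simp
    have vx: "v x = u (n y)" unfolding xy by (rule v[OF y])
    show ?thesis
    proof (cases "y \<in> (\<Union>k. B k)")
      case True
      then obtain k where k: "y \<in> B k" by blast
      have "n y \<in> B (Suc k)" using k unfolding BS by blast
      then have "v x = f (Suc k) (n y)" using vx u(2) by simp
      also have "\<dots> = x" using f_n[OF y] u(2)[OF k] xy by simp
      finally have "v x = x" .
      moreover have "u y \<in> B k" using u(2)[OF k] fB k by (metis imageI)
      then have "x \<in> B (Suc k)" unfolding xy BS by blast
      then have "x \<notin> A" using disj[of 0 "Suc k"] B0 by auto
      ultimately show ?thesis by simp
    next
      case False
      then have x_eq: "x = n y" using u_out y xy by simp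
      show ?thesis
      proof (cases "x \<in> A")
        case True
        then show ?thesis using vx x_eq u(2)[of x 0] B0 f0 by simp
      next
        case xA: False
        have "x \<notin> B k" for k
        proof (cases k)
          case 0
          then show ?thesis using xA B0 by simp
        next
          case (Suc m)
          show ?thesis
          proof
            assume "x \<in> B k"
            then obtain z where "z \<in> B m" "n y = n z" unfolding Suc BS x_eq by blast
            then have "y \<in> B m" using inj_onD[OF n_inj _ y] BCh[of m] by blast
            then show False using False by blast
          qed
        qed
        then show ?thesis using vx x_eq u_out[of x] x xA by simp
      qed
    qed
  qed
  moreover have "v \<in> extensional Ch" by (simp add: v_def compose_def)
  ultimately have "v = (\<lambda>x\<in>Ch. if x \<in> A then g x else x)" by (intro extensionalityI[of _ Ch]) auto
  then show ?thesis using vN by simp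
qed

end

text \<open>Here \<open>connected\<close> is irreducibility together with \<open>S \<noteq> {s}\<close>: there is a path of positive length even
  from \<open>s\<close> to itself.\<close>

locale thick_universal_normal_subgroup = universal_normal_subgroup +
  fixes s :: 'a
  assumes thick_panels: "t \<in> S \<Longrightarrow> c \<in> Ch \<Longrightarrow> \<exists>d\<in>pan t c. d \<noteq> a \<and> d \<noteq> b"
    and s: "s \<in> S"
    and connected: "t \<in> S \<Longrightarrow> (t, s) \<in> (diagram_edges W S)\<^sup>+"
    and nontrivial: "\<exists>m\<in>N. \<exists>c\<in>Ch. m c \<noteq> c"
begin

text \<open>Some \<open>m \<in> N\<close> moves a wing off itself, and this wing contains the complement of some \<open>wing s e\<close>. So
  \<open>m\<close> maps the complement of \<open>wing s e\<close> into \<open>wing s e\<close>; conjugate by an element that takes \<open>e\<close> to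
  \<open>p\<close>.\<close>

lemma wing_absorbs_complement:
  assumes p: "p \<in> Ch"
  shows "\<exists>n\<in>N. \<forall>x\<in>Ch - wing s p. n x \<in> wing s p"
proof -
  obtain m c where m: "m \<in> N" and c: "c \<in> Ch" "m c \<noteq> c" using nontrivial by blast
  have mU: "m \<in> U" by (rule N_in_U[OF m])
  obtain t d where t: "t \<in> S" and d: "d \<in> Ch" and md: "\<forall>e\<in>wing t d. m e \<notin> wing t d"
    using moved_wing_exists[OF _ U_isometry[OF mU] thick_panels[OF _ c(1)] c] U_closed[OF mU] by blast
  obtain e where e: "e \<in> Ch" "Ch - wing s e \<subseteq> wing t d"
    using wing_contains_wing_complement[OF connected[OF t] d] by blast
  obtain u where u: "u \<in> U" "u e = p" using U_chamber_transitive[OF e(1) p] by blast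
  define n where "n = compose Ch (compose Ch u m) (uinv u)"
  have "n x \<in> wing s p" if x: "x \<in> Ch - wing s p" for x
  proof -
    define y where "y = uinv u x"
    have y: "y \<in> Ch" "u y = x" unfolding y_def using x u(1) by (auto intro: U_closed uinv_U uinv_right)
    have "y \<notin> wing s e" using U_wing[OF u(1) e(1) y(1), of s] y(2) u(2) x by simp
    then have "m y \<notin> wing t d" using md e(2) y(1) by blast
    then have "m y \<in> wing s e" using e(2) U_closed[OF mU y(1)] by blast
    then have "u (m y) \<in> wing s p" using U_wing[OF u(1) e(1) U_closed[OF mU y(1)], of s] u(2) by simp
    moreover have "n x = u (m y)" using x y(1) by (simp add: n_def compose_def flip: y_def)
    ultimately show ?thesis by simp
  qed
  moreover have "n \<in> N" unfolding n_def by (rule conj_N[OF u(1) m])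
  ultimately show ?thesis by blast
qed

lemma wing_complement_into_wing:
  assumes c: "c \<in> Ch" and pq: "p \<in> pan s c" "q \<in> pan s c" "p \<noteq> q"
  shows "\<exists>n\<in>N. \<forall>x\<in>Ch - wing s p. n x \<in> wing s q"
proof -
  have Ch: "p \<in> Ch" "q \<in> Ch" using pq panel_subset by auto
  obtain n1 where n1: "n1 \<in> N" "\<forall>x\<in>Ch - wing s p. n1 x \<in> wing s p"
    using wing_absorbs_complement[OF Ch(1)] by blast
  obtain n2 where n2: "n2 \<in> N" "\<forall>x\<in>Ch - wing s q. n2 x \<in> wing s q"
    using wing_absorbs_complement[OF Ch(2)] by blast
  have "compose Ch n2 n1 x \<in> wing s q" if x: "x \<in> Ch - wing s p" for x
  proof -
    have "n1 x \<in> wing s p" using n1 x by blast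
    then have "n1 x \<in> Ch - wing s q" using wing_disjoint[OF c s pq] wing_subset by blast
    then show ?thesis using n2(2) x by (simp add: compose_def)
  qed
  then show ?thesis using compose_N[OF n2(1) n1(1)] by blast
qed

text \<open>The sets \<open>A Z\<close> are unions of wings and \<open>r Z\<close> is the restriction of \<open>g\<close> to \<open>A Z\<close>. The boundary condition of
  \<open>contraction\<close> holds because a panel that is only partly contained in \<open>A Z\<close> belongs to the tree-wall.\<close>

lemma fixator_subset_N:
  assumes c: "c \<in> Ch" and g: "g \<in> U"
    and fixed: "\<And>x. x \<in> res (insert s (perp s)) c \<Longrightarrow> \<forall>y\<in>pan s x. g y = y"
  shows "g \<in> N"
proof -
  let ?J = "insert s (perp s)"
  have pan_J: "p \<in> res ?J c" if "p \<in> pan s c" for p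
    using panel_in_residue[OF c, of s ?J] that by auto
  have gp: "g p = p" if "p \<in> pan s c" for p
    using fixed[OF pan_J[OF that]] self_in_panel panel_subset that by blast
  have g_wing: "g x \<in> wing s p \<longleftrightarrow> x \<in> wing s p" if "p \<in> pan s c" "x \<in> Ch" for p x
    using U_wing[OF g _ that(2), of p s] gp[OF that(1)] that panel_subset by auto
  define A where "A Z = (\<Union>z\<in>Z. wing s z)" for Z
  define r where "r Z = (\<lambda>x\<in>Ch. if x \<in> A Z then g x else x)" for Z
  have rN: "r Z \<in> N" if Z: "Z \<subseteq> pan s c" and pq: "p \<in> pan s c - Z" "q \<in> pan s c - Z" "p \<noteq> q" for Z p q
  proof -
    obtain n where n: "n \<in> N" "\<forall>x\<in>Ch - wing s p. n x \<in> wing s q"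
      using wing_complement_into_wing[OF c, of p q] pq by blast
    have dis: "wing s z \<inter> wing s z' = {}" if "z \<in> pan s c" "z' \<in> pan s c" "z \<noteq> z'" for z z'
      by (rule wing_disjoint[OF c s that])
    show ?thesis unfolding r_def
    proof (rule contraction[OF g n(1), where H = "Ch - wing s p"])
      show "A Z \<subseteq> Ch - wing s p"
      proof
        fix x assume "x \<in> A Z"
        then obtain z where "z \<in> Z" "x \<in> wing s z" by (auto simp: A_def)
        then show "x \<in> Ch - wing s p" using dis[of z p] Z pq wing_subset by blast
      qed
      show "Ch - wing s p \<subseteq> Ch" by blast
      show "n ` (Ch - wing s p) \<subseteq> Ch - wing s p"
        using n(2) dis[of q p] pq wing_subset by blast
      show "n ` (Ch - wing s p) \<inter> A Z = {}"
      proof -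
        have "wing s q \<inter> wing s z = {}" if "z \<in> Z" for z using dis[of q z] that Z pq by blast
        then show ?thesis using n(2) unfolding A_def by blast
      qed
      show "g ` A Z = A Z"
      proof
        show "g ` A Z \<subseteq> A Z"
        proof
          fix y assume "y \<in> g ` A Z"
          then obtain x z where z: "z \<in> Z" "x \<in> wing s z" "y = g x" by (auto simp: A_def)
          then have "y \<in> wing s z" using g_wing[of z x] Z wing_subset[of s z] by blast
          then show "y \<in> A Z" using z(1) by (auto simp: A_def)
        qed
        show "A Z \<subseteq> g ` A Z"
        proof
          fix x assume "x \<in> A Z"
          then obtain z where z: "z \<in> Z" "x \<in> wing s z" by (auto simp: A_def)
          have x: "x \<in> Ch" using z wing_subset by blast
          define y where "y = uinv g x"
          have y: "g y = x" "y \<in> Ch" unfolding y_def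
            using uinv_right[OF g x] U_closed[OF uinv_U[OF g] x] by blast+
          have "z \<in> pan s c" using z(1) Z by blast
          then have "y \<in> wing s z" using g_wing[OF _ y(2)] z(2) y(1) by simp
          then have "y \<in> A Z" using z(1) by (auto simp: A_def)
          then show "x \<in> g ` A Z" using y(1) by (metis imageI)
        qed
      qed
      fix t d assume td: "t \<in> S" "d \<in> Ch"
      show "pan t d \<subseteq> A Z \<or> (\<forall>x\<in>pan t d \<inter> A Z. g x = x)"
      proof (cases "pan t d \<subseteq> A Z")
        case False
        then obtain y where y: "y \<in> pan t d" "y \<notin> A Z" by blast
        have yCh: "y \<in> Ch" using y panel_subset by blast
        obtain q' where q': "q' \<in> pan s c" "y \<in> wing s q'" using wing_cover[OF c s yCh] .
        have "g x = x" if x: "x \<in> pan t d" "x \<in> A Z" for x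
        proof -
          obtain z where z: "z \<in> Z" "x \<in> wing s z" using x by (auto simp: A_def)
          have ne: "z \<noteq> q'" using z(1) q'(2) y(2) by (auto simp: A_def)
          have zp: "z \<in> pan s c" using z Z by blast
          have "x \<noteq> y" using x y by auto
          then have xy: "\<delta> x y = t" by (rule panel_adjacent[OF td(2,1) x(1) y(1)])
          have "x \<in> res (perp s) z"
            by (rule wing_boundary(3)[OF c s td(1) zp q'(1) ne z(2) q'(2) xy])
          then have "x \<in> res ?J z" using residue_mono[of "perp s" ?J z] by blast
          then have "x \<in> res ?J c" by (rule residue_trans[OF pan_J[OF zp]])
          moreover have "x \<in> Ch" using x panel_subset by blast
          ultimately show ?thesis using fixed self_in_panel by blast
        qed
        then show ?thesis by blast
      qed blast
    qed
  qed
  obtain p q q' where three: "p \<in> pan s c" "q \<in> pan s c" "q' \<in> pan s c" "p \<noteq> q" "p \<noteq> q'" "q \<noteq> q'"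
    using thick_panels[OF s c] by metis
  define Z where "Z = pan s c - {p, q}"
  have "r {p} \<in> N" by (rule rN[of _ q q']) (use three in auto)
  moreover have "r {q} \<in> N" by (rule rN[of _ p q']) (use three in auto)
  moreover have "r Z \<in> N" by (rule rN[of _ p q]) (use three Z_def in auto)
  ultimately have comp: "compose Ch (r {p}) (compose Ch (r {q}) (r Z)) \<in> N" by (intro compose_N)
  have "compose Ch (r {p}) (compose Ch (r {q}) (r Z)) x = g x" if x: "x \<in> Ch" for x
  proof -
    obtain z where z: "z \<in> pan s c" "x \<in> wing s z" using wing_cover[OF c s x] .
    have gx: "g x \<in> wing s z" "g x \<in> Ch" using g_wing[OF z(1) x] z U_closed[OF g x] by auto
    have in_A: "y \<in> A V \<longleftrightarrow> z \<in> V" if "V \<subseteq> pan s c" "y \<in> wing s z" for V y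
      using that wing_disjoint[OF c s _ z(1)] unfolding A_def by blast
    have r_eq: "r V y = (if z \<in> V then g y else y)" if "V \<subseteq> pan s c" "y \<in> wing s z" for V y
      using in_A[OF that] that(2) wing_subset[of s z] by (auto simp: r_def)
    have sub: "{p} \<subseteq> pan s c" "{q} \<subseteq> pan s c" "Z \<subseteq> pan s c" using three Z_def by auto
    consider "z = p" | "z = q" | "z \<in> Z" using z Z_def by blast
    then show ?thesis
      by cases (use x z gx three in \<open>simp_all add: compose_def r_eq sub Z_def\<close>)
  qed
  then have "compose Ch (r {p}) (compose Ch (r {q}) (r Z)) = g"
    using Bij_imp_extensional[of g Ch] U_Bij g by (intro extensionalityI[of _ Ch]) auto
  then show ?thesis using comp by simp
qed

end

section \<open>The fixator of a tree-wall\<close>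

theorem proposition3p21:
  fixes W :: "('w, 'x) monoid_scheme" and S :: "'w set"
    and Ch :: "'c set" and \<delta> :: "'c \<Rightarrow> 'c \<Rightarrow> 'w"
    and Y :: "'w \<Rightarrow> 'y set" and h :: "'w \<Rightarrow> 'c \<Rightarrow> 'y" and G :: "'w \<Rightarrow> ('y \<Rightarrow> 'y) set"
    and U N :: "('c \<Rightarrow> 'c) set" and s :: 'w and T :: "'c set set"
  assumes "building W S Ch \<delta>"
    and "right_angled W S" and "irreducible_type W S"
    and "semi_regular S Ch \<delta> Y" and "thick S Y"
    and "\<And>t. t \<in> S \<Longrightarrow> legal_coloring S Ch \<delta> t (Y t) (h t)"
    and "\<And>t. t \<in> S \<Longrightarrow> transitive_perm_group (Y t) (G t)"
    and "U = universal_group S Ch \<delta> Y h G"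
    and "s \<in> S" and "tree_wall W S Ch \<delta> s T"
    and "N \<lhd> (BijGroup Ch\<lparr>carrier := U\<rparr>)"
    and "N \<noteq> {\<one>\<^bsub>BijGroup Ch\<^esub>}"
  shows "fixator U T \<subseteq> N"
proof
  fix g assume gT: "g \<in> fixator U T"
  interpret building W S Ch \<delta> by fact
  interpret universal_normal_subgroup W S Ch \<delta> Y h G U N
    by intro_locales (rule right_angled_coxeter_system_axioms.intro colored_building_axioms.intro
        universal_group_building_axioms.intro universal_normal_subgroup_axioms.intro, fact+)+
  have g: "g \<in> U" and g_fix: "\<And>c. c \<in> \<Union>T \<Longrightarrow> g c = c" using gT by (auto simp: fixator_def)
  let ?J = "insert s (perp s)"
  obtain c where c: "c \<in> Ch" and T: "T = {P \<in> pan s ` Ch. P \<subseteq> res ?J c}"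
    using assms(10) unfolding tree_wall_def perp_def by auto
  have fixed: "\<forall>y\<in>pan s x. g y = y" if x: "x \<in> res ?J c" for x
  proof -
    have xCh: "x \<in> Ch" using x residue_subset[OF c] by blast
    have "pan s x \<subseteq> res ?J c"
      using panel_in_residue[OF xCh, of s ?J] residue_trans[OF x] by blast
    then have "pan s x \<in> T" using xCh T by blast
    then show ?thesis using g_fix by blast
  qed
  show "g \<in> N"
  proof (cases "S = {s}")
    case True
    have "g x = x" if x: "x \<in> Ch" for x
    proof -
      obtain ws where "ws \<in> lists S" "word_prod W ws = \<delta> c x"
        using reduced_word_exists[OF \<delta>_closed[OF c x]] by blast
      then have "x \<in> res S c" using word_in_residue[OF c x, of S ws] by simp
      then have "x \<in> res ?J c" using residue_mono[of S ?J c] True by blast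
      then show ?thesis using fixed self_in_panel[OF x] by blast
    qed
    then have "g = (\<lambda>x\<in>Ch. x)"
      using Bij_imp_extensional[of g Ch] U_Bij g by (intro extensionalityI[of _ Ch]) auto
    then show ?thesis using one_in_N by simp
  next
    case False
    then obtain r where r: "r \<in> S" "r \<noteq> s" using \<open>s \<in> S\<close> by blast
    have irr: "(a, b) \<in> (diagram_edges W S)\<^sup>*" if "a \<in> S" "b \<in> S" for a b
      using \<open>irreducible_type W S\<close> that by (simp add: irreducible_type_def)
    have "(r, s) \<in> (diagram_edges W S)\<^sup>+"
      using irr[OF r(1) \<open>s \<in> S\<close>] r(2) by (simp add: rtrancl_eq_or_trancl)
    then have conn: "(t, s) \<in> (diagram_edges W S)\<^sup>+" if "t \<in> S" for t
      using irr[OF that r(1)] by (rule rtrancl_trancl_trancl[rotated])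
    have thick3: "\<exists>d\<in>pan t e. d \<noteq> a \<and> d \<noteq> b" if t: "t \<in> S" and e: "e \<in> Ch" for t e a b
    proof -
      have "{..<3::nat} \<lesssim> Y t" using \<open>thick S Y\<close> t by (simp add: thick_def)
      then obtain i :: "nat \<Rightarrow> 'y" where i: "inj_on i {..<3}" "i ` {..<3} \<subseteq> Y t"
        by (auto simp: lepoll_def)
      have "\<not> i ` {..<3} \<subseteq> {h t a, h t b}"
      proof
        assume "i ` {..<3} \<subseteq> {h t a, h t b}"
        then have "card (i ` {..<3}) \<le> card {h t a, h t b}" by (intro card_mono) auto
        also have "\<dots> \<le> 2" by (simp add: card_insert_if)
        finally show False using card_image[OF i(1)] by simp
      qed
      then obtain y where "y \<in> Y t" "y \<noteq> h t a" "y \<noteq> h t b" using i(2) by blast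
      then show ?thesis using color_surj[OF t e] by metis
    qed
    have nontriv: "\<exists>m\<in>N. \<exists>c\<in>Ch. m c \<noteq> c"
    proof (rule ccontr)
      assume no: "\<not> ?thesis"
      have "m = (\<lambda>x\<in>Ch. x)" if "m \<in> N" for m
        using no that Bij_imp_extensional[of m Ch] U_Bij N_in_U[OF that]
        by (intro extensionalityI[of _ Ch]) auto
      then have "N = {\<lambda>x\<in>Ch. x}" using one_in_N by blast
      then show False using assms(12) by (simp add: BijGroup_def)
    qed
    interpret thick_universal_normal_subgroup W S Ch \<delta> Y h G U N s
      by intro_locales (rule thick_universal_normal_subgroup_axioms.intro,
        fact thick3, fact \<open>s \<in> S\<close>, fact conn, fact nontriv)
    show ?thesis by (rule fixator_subset_N[OF c g fixed])
  qed
qed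

end
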